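(* Let $G$ be a closed subgroup of $\mathcal{S}_\infty$ with a comeager conjugacy class and the small index property. Then the wreath product $W=G\wr\mathcal{S}_\infty$ is a Polish group with the small index property.
   Context: $\mathcal{S}_\infty$ is the group of all permutations of a countably infinite set with the topology of pointwise convergence. $G$ is a closed subgroup of the permutation group of a countable set $\Lambda$, and $\mathcal{S}_\infty$ is the full permutation group of a countably infinite set $\Omega$. The wreath product $G\wr\mathcal{S}_\infty=G^\Omega\rtimes\mathcal{S}_\infty$, where $\sigma\cdot(g_\omega)_\omega=(g_{\sigma^{-1}\omega})_\omega$, acts faithfully on $\Lambda\times\Omega$ by $((g_\omega),\sigma)\cdot(\lambda,\omega')=(g_{\sigma(\omega')}\lambda,\sigma(\omega'))$; this embeds it as a closed subgroup of the permutation group of $\Lambda\times\Omega$, and $W$ is given the induced topology. A Polish group has the small index property if every subgroup of index less than $2^{\aleph_0}$ is open. A conjugacy class is comeager if it contains a countable intersection of dense open sets. *)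

theory Defs
  imports "HOL-Analysis.Analysis"
begin

text \<open>Permutations of a type 'x (the countable set is the universe of a countable infinite type).
  The topology of pointwise convergence on self-maps of 'x is the product topology of
  discrete copies of 'x; the symmetric group carries the subspace topology.\<close>

definition pointwise_top :: "('x \<Rightarrow> 'x) topology" where
  "pointwise_top = product_topology (\<lambda>_. discrete_topology UNIV) UNIV"

definition Sym :: "('x \<Rightarrow> 'x) set" where
  "Sym = {f. bij f}"

definition sym_top :: "('x \<Rightarrow> 'x) topology" where
  "sym_top = subtopology pointwise_top Sym"

definition grp_top :: "('x \<Rightarrow> 'x) set \<Rightarrow> ('x \<Rightarrow> 'x) topology" where
  "grp_top G = subtopology sym_top G"

definition perm_group :: "('x \<Rightarrow> 'x) set \<Rightarrow> bool" where
  "perm_group G \<longleftrightarrow> G \<subseteq> Sym \<and> id \<in> G \<and> (\<forall>f\<in>G. \<forall>g\<in>G. f \<circ> g \<in> G) \<and> (\<forall>f\<in>G. inv f \<in> G)"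

definition closed_perm_group :: "('x \<Rightarrow> 'x) set \<Rightarrow> bool" where
  "closed_perm_group G \<longleftrightarrow> perm_group G \<and> closedin sym_top G"

definition subgroup_of :: "('x \<Rightarrow> 'x) set \<Rightarrow> ('x \<Rightarrow> 'x) set \<Rightarrow> bool" where
  "subgroup_of H G \<longleftrightarrow> H \<subseteq> G \<and> perm_group H"

definition left_cosets :: "('x \<Rightarrow> 'x) set \<Rightarrow> ('x \<Rightarrow> 'x) set \<Rightarrow> ('x \<Rightarrow> 'x) set set" where
  "left_cosets G H = (\<lambda>g. (\<lambda>h. g \<circ> h) ` H) ` G"

definition small_index_property :: "('x \<Rightarrow> 'x) set \<Rightarrow> bool" where
  "small_index_property G \<longleftrightarrow>
     (\<forall>H. subgroup_of H G \<and> ordLess2 (card_of (left_cosets G H)) (card_of (UNIV :: nat set set))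
          \<longrightarrow> openin (grp_top G) H)"

definition conj_class :: "('x \<Rightarrow> 'x) set \<Rightarrow> ('x \<Rightarrow> 'x) \<Rightarrow> ('x \<Rightarrow> 'x) set" where
  "conj_class G g = {h \<circ> g \<circ> inv h | h. h \<in> G}"

definition comeager_in :: "'a topology \<Rightarrow> 'a set \<Rightarrow> bool" where
  "comeager_in T A \<longleftrightarrow>
     (\<exists>D :: nat \<Rightarrow> 'a set. (\<forall>n. openin T (D n) \<and> T closure_of (D n) = topspace T)
        \<and> (\<Inter>n. D n) \<inter> topspace T \<subseteq> A)"

definition has_comeager_conj_class :: "('x \<Rightarrow> 'x) set \<Rightarrow> bool" where
  "has_comeager_conj_class G \<longleftrightarrow> (\<exists>g\<in>G. comeager_in (grp_top G) (conj_class G g))"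

definition Polish_space :: "'a topology \<Rightarrow> bool" where
  "Polish_space T \<longleftrightarrow> completely_metrizable_space T \<and> separable_space T"

definition Polish_perm_group :: "('x \<Rightarrow> 'x) set \<Rightarrow> bool" where
  "Polish_perm_group G \<longleftrightarrow> perm_group G
     \<and> continuous_map (prod_topology (grp_top G) (grp_top G)) (grp_top G) (\<lambda>(f, g). f \<circ> g)
     \<and> continuous_map (grp_top G) (grp_top G) inv
     \<and> Polish_space (grp_top G)"

text \<open>The wreath product G wr S_infinity, realised as a permutation group of 'l \<times> 'w:
  ((g_w), s) acts by (l, w') \<mapsto> (g_{s w'} l, s w').\<close>
definition wreath_action :: "('w \<Rightarrow> ('l \<Rightarrow> 'l)) \<Rightarrow> ('w \<Rightarrow> 'w) \<Rightarrow> ('l \<times> 'w \<Rightarrow> 'l \<times> 'w)" where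
  "wreath_action gs s = (\<lambda>(l, w'). (gs (s w') l, s w'))"

definition wreath :: "('l \<Rightarrow> 'l) set \<Rightarrow> ('l \<times> 'w \<Rightarrow> 'l \<times> 'w) set" where
  "wreath G = {wreath_action gs s | gs s. (\<forall>w. gs w \<in> G) \<and> s \<in> (Sym :: ('w \<Rightarrow> 'w) set)}"

end

theory Submission
  imports Defs
begin

text \<open>The wreath product W is closed in the symmetric group of the product set, hence Polish.
  For the small index property let H have index less than the continuum in W, and write W(A) for the
  elements of W supported on the fibres over A. Cut the index set into infinitely many infinite
  pieces: a diagonal argument produces a piece A on which every element of W(A) is induced by
  an element of H preserving A. A family of continuum many commuting shifts of A then puts into H
  a permutation s of A for which the translates of some infinite set B under the powers of s are
  pairwise disjoint. Any g in W(B) is the commutator of s with the product of the conjugates of g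
  by all nonnegative powers of s, so W(B) is contained in H. A further family of continuum many involutions
  yields an element of H carrying B onto a set that contains all but finitely many points of the
  complement of B, and two such subgroups generate W(M) with M cofinite. Finally, the small index
  property of G takes care of the finitely many remaining fibres.\<close>

section \<open>Permutation groups and pointwise convergence\<close>

lemma perm_groupD:
  assumes "perm_group G"
  shows "G \<subseteq> Sym" "id \<in> G" "f \<in> G \<Longrightarrow> g \<in> G \<Longrightarrow> f \<circ> g \<in> G" "f \<in> G \<Longrightarrow> inv f \<in> G" "f \<in> G \<Longrightarrow> bij f"
  using assms by (auto simp: perm_group_def Sym_def)

lemma perm_group_cancel:
  assumes "perm_group G" "f \<in> G"
  shows "f \<circ> g \<in> G \<longleftrightarrow> g \<in> G"
proof
  assume "f \<circ> g \<in> G"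
  then have "inv f \<circ> (f \<circ> g) \<in> G"
    using assms perm_groupD by blast
  moreover have "inv f \<circ> (f \<circ> g) = g"
    using perm_groupD(5)[OF assms] by (simp add: fun_eq_iff bij_is_inj)
  ultimately show "g \<in> G" by simp
qed (use assms perm_groupD in blast)

lemma perm_group_cancel_right:
  assumes "perm_group G" "f \<in> G"
  shows "g \<circ> f \<in> G \<longleftrightarrow> g \<in> G"
proof
  assume "g \<circ> f \<in> G"
  then have "(g \<circ> f) \<circ> inv f \<in> G"
    using assms perm_groupD by blast
  moreover have "(g \<circ> f) \<circ> inv f = g"
    using perm_groupD(5)[OF assms] by (simp add: fun_eq_iff bij_is_surj surj_f_inv_f)
  ultimately show "g \<in> G" by simp
qed (use assms perm_groupD in blast)

lemma topspace_grp_top: "G \<subseteq> Sym \<Longrightarrow> topspace (grp_top G) = G"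
  by (auto simp: grp_top_def sym_top_def pointwise_top_def)

text \<open>A basic open set of a product of discrete spaces prescribes values at finitely many
  points, so the later topology reduces to finite approximation.\<close>

lemma openin_pointwise_top:
  "openin pointwise_top U \<longleftrightarrow> (\<forall>f\<in>U. \<exists>S. finite S \<and> (\<forall>f'. (\<forall>x\<in>S. f' x = f x) \<longrightarrow> f' \<in> U))"
proof (intro iffI ballI)
  fix f assume U: "openin pointwise_top U" "f \<in> U"
  have "\<exists>V. finite {i. V i \<noteq> UNIV} \<and> f \<in> Pi\<^sub>E UNIV V \<and> Pi\<^sub>E UNIV V \<subseteq> U"
    using U unfolding pointwise_top_def openin_product_topology_alt by simp
  then obtain V where V: "finite {i. V i \<noteq> UNIV}" "f \<in> Pi\<^sub>E UNIV V" "Pi\<^sub>E UNIV V \<subseteq> U"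
    by (elim exE conjE)
  have "f' \<in> U" if f': "\<forall>x\<in>{i. V i \<noteq> UNIV}. f' x = f x" for f'
  proof -
    have "f' i \<in> V i" for i
      using f' PiE_mem[OF V(2), of i] by (cases "V i = UNIV") simp_all
    then have "f' \<in> Pi\<^sub>E UNIV V" by (simp add: PiE_UNIV_domain)
    then show ?thesis using V(3) by (rule rev_subsetD)
  qed
  then show "\<exists>S. finite S \<and> (\<forall>f'. (\<forall>x\<in>S. f' x = f x) \<longrightarrow> f' \<in> U)"
    by (intro exI[of _ "{i. V i \<noteq> UNIV}"] conjI allI impI V(1))
next
  assume *: "\<forall>f\<in>U. \<exists>S. finite S \<and> (\<forall>f'. (\<forall>x\<in>S. f' x = f x) \<longrightarrow> f' \<in> U)"
  have "\<exists>V. finite {i. V i \<noteq> UNIV} \<and> f \<in> Pi\<^sub>E UNIV V \<and> Pi\<^sub>E UNIV V \<subseteq> U" if f: "f \<in> U" for f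
  proof -
    obtain S where S: "finite S" "\<forall>f'. (\<forall>x\<in>S. f' x = f x) \<longrightarrow> f' \<in> U"
      using bspec[OF * f] by (elim exE conjE)
    let ?V = "\<lambda>x. if x \<in> S then {f x} else UNIV"
    have "finite {i. ?V i \<noteq> UNIV}"
      by (rule finite_subset[OF _ S(1)]) (auto split: if_splits)
    moreover have "f \<in> Pi\<^sub>E UNIV ?V" by (simp add: PiE_UNIV_domain)
    moreover have "Pi\<^sub>E UNIV ?V \<subseteq> U"
    proof
      fix f' assume f': "f' \<in> Pi\<^sub>E UNIV ?V"
      have "f' x = f x" if "x \<in> S" for x
        using PiE_mem[OF f', of x] that by simp
      then show "f' \<in> U" using S(2) by simp
    qed
    ultimately show ?thesis by (intro exI[of _ ?V] conjI)
  qed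
  then show "openin pointwise_top U"
    unfolding pointwise_top_def openin_product_topology_alt by simp
qed

lemma grp_top_eq: "G \<subseteq> Sym \<Longrightarrow> grp_top G = subtopology pointwise_top G"
  by (simp add: grp_top_def sym_top_def subtopology_subtopology Int_absorb1)

lemma openin_grp_top:
  assumes "G \<subseteq> Sym"
  shows "openin (grp_top G) U \<longleftrightarrow>
    U \<subseteq> G \<and> (\<forall>f\<in>U. \<exists>S. finite S \<and> (\<forall>f'\<in>G. (\<forall>x\<in>S. f' x = f x) \<longrightarrow> f' \<in> U))"
proof (intro iffI conjI ballI)
  assume U: "openin (grp_top G) U"
  show "U \<subseteq> G"
    using openin_subset[OF U] topspace_grp_top[OF assms] by simp
  fix f assume f: "f \<in> U"
  obtain T where T: "openin pointwise_top T" "U = T \<inter> G"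
    using U by (auto simp: grp_top_eq[OF assms] openin_subtopology)
  then obtain S where "finite S" "\<forall>f'. (\<forall>x\<in>S. f' x = f x) \<longrightarrow> f' \<in> T"
    using f by (auto simp: openin_pointwise_top)
  then show "\<exists>S. finite S \<and> (\<forall>f'\<in>G. (\<forall>x\<in>S. f' x = f x) \<longrightarrow> f' \<in> U)"
    using T(2) by blast
next
  assume *: "U \<subseteq> G \<and> (\<forall>f\<in>U. \<exists>S. finite S \<and> (\<forall>f'\<in>G. (\<forall>x\<in>S. f' x = f x) \<longrightarrow> f' \<in> U))"
  then have "\<exists>S. \<forall>f\<in>U. finite (S f) \<and> (\<forall>f'\<in>G. (\<forall>x\<in>S f. f' x = f x) \<longrightarrow> f' \<in> U)"
    by (intro bchoice) simp
  then obtain S where S: "\<forall>f\<in>U. finite (S f) \<and> (\<forall>f'\<in>G. (\<forall>x\<in>S f. f' x = f x) \<longrightarrow> f' \<in> U)" ..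
  let ?T = "{f'. \<exists>f\<in>U. \<forall>x\<in>S f. f' x = f x}"
  have "\<exists>F. finite F \<and> (\<forall>f''. (\<forall>x\<in>F. f'' x = f' x) \<longrightarrow> f'' \<in> ?T)" if f': "f' \<in> ?T" for f'
  proof -
    obtain f where f: "f \<in> U" "\<forall>x\<in>S f. f' x = f x" using f' by auto
    then show ?thesis by (intro exI[of _ "S f"]) (auto simp: S)
  qed
  then have "openin pointwise_top ?T"
    unfolding openin_pointwise_top by blast
  moreover have "U = ?T \<inter> G"
    using * S by auto
  ultimately show "openin (grp_top G) U"
    unfolding grp_top_eq[OF assms] openin_subtopology by (intro exI[of _ ?T] conjI)
qed

lemma closedin_sym_top:
  fixes G :: "('x \<Rightarrow> 'x) set"
  shows "closedin sym_top G \<longleftrightarrow> G \<subseteq> Sym \<and>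
    (\<forall>f\<in>Sym - G. \<exists>S. finite S \<and> (\<forall>f'\<in>Sym. (\<forall>x\<in>S. f' x = f x) \<longrightarrow> f' \<in> Sym - G))"
proof -
  have st: "sym_top = grp_top (Sym :: ('x \<Rightarrow> 'x) set)"
    by (simp add: grp_top_eq sym_top_def)
  have "topspace (grp_top Sym) = (Sym :: ('x \<Rightarrow> 'x) set)"
    by (simp add: topspace_grp_top)
  then have "closedin sym_top G \<longleftrightarrow> G \<subseteq> Sym \<and> openin (grp_top Sym) (Sym - G)"
    unfolding closedin_def by (simp add: st)
  then show ?thesis
    by (simp add: openin_grp_top)
qed

lemma closedin_sym_topD:
  assumes "closedin sym_top G" "f \<in> Sym"
    and approx: "\<And>S. finite S \<Longrightarrow> \<exists>f'\<in>G. \<forall>x\<in>S. f' x = f x"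
  shows "f \<in> G"
proof (rule ccontr)
  assume "f \<notin> G"
  then have "f \<in> Sym - G" using assms(2) by simp
  then obtain S where S: "finite S" "\<forall>f'\<in>Sym. (\<forall>x\<in>S. f' x = f x) \<longrightarrow> f' \<in> Sym - G"
    using assms(1) unfolding closedin_sym_top by meson
  obtain f' where "f' \<in> G" "\<forall>x\<in>S. f' x = f x"
    using approx[OF S(1)] ..
  moreover have "f' \<in> Sym"
    using \<open>f' \<in> G\<close> assms(1) unfolding closedin_sym_top by auto
  ultimately show False using S(2) by simp
qed

lemma closedin_sym_topI:
  assumes "G \<subseteq> Sym"
    and approx: "\<And>f. f \<in> Sym \<Longrightarrow> (\<And>S. finite S \<Longrightarrow> \<exists>f'\<in>G. \<forall>x\<in>S. f' x = f x) \<Longrightarrow> f \<in> G"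
  shows "closedin sym_top G"
  unfolding closedin_sym_top
proof (intro conjI ballI)
  show "G \<subseteq> Sym" by fact
  fix f assume f: "f \<in> Sym - G"
  then obtain S where "finite S" "\<not> (\<exists>f'\<in>G. \<forall>x\<in>S. f' x = f x)"
    using approx[of f] by (meson DiffE)
  then have S: "finite S" "\<And>f'. f' \<in> G \<Longrightarrow> \<exists>x\<in>S. f' x \<noteq> f x"
    by auto
  show "\<exists>S. finite S \<and> (\<forall>f'\<in>Sym. (\<forall>x\<in>S. f' x = f x) \<longrightarrow> f' \<in> Sym - G)"
    by (intro exI[of _ S]) (use S in auto)
qed

text \<open>The topology is generated by the evaluations at points, whose values lie in discrete
  spaces, so only sets prescribing a single value have to be checked.\<close>

lemma continuous_map_grp_top:
  fixes G :: "('x \<Rightarrow> 'x) set"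
  assumes "G \<subseteq> Sym" "\<And>t. t \<in> topspace T \<Longrightarrow> \<phi> t \<in> G"
    and "\<And>x y. openin T {t \<in> topspace T. \<phi> t x = y}"
  shows "continuous_map T (grp_top G) \<phi>"
proof -
  have "continuous_map T (discrete_topology UNIV) (\<lambda>t. \<phi> t x)" for x
    unfolding continuous_map_def
  proof (intro conjI allI impI)
    fix U :: "'x set" assume "openin (discrete_topology UNIV) U"
    have "{t \<in> topspace T. \<phi> t x \<in> U} = (\<Union>y\<in>U. {t \<in> topspace T. \<phi> t x = y})" by auto
    then show "openin T {t \<in> topspace T. \<phi> t x \<in> U}"
      using assms(3) by auto
  qed auto
  then show ?thesis
    unfolding grp_top_eq[OF assms(1)] pointwise_top_def
    using assms(2) by (auto simp: continuous_map_in_subtopology continuous_map_componentwise_UNIV)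
qed

lemma continuous_map_grp_top_comp:
  assumes "perm_group G"
  shows "continuous_map (prod_topology (grp_top G) (grp_top G)) (grp_top G) (\<lambda>(f, g). f \<circ> g)"
proof (rule continuous_map_grp_top)
  note G = perm_groupD[OF assms]
  show "G \<subseteq> Sym" by (fact G)
  show "(case t of (f, g) \<Rightarrow> f \<circ> g) \<in> G" if "t \<in> topspace (prod_topology (grp_top G) (grp_top G))" for t
    using that G(3) by (auto simp: topspace_grp_top[OF G(1)])
  fix x y
  have open1: "openin (grp_top G) {f \<in> G. f x = y}" for x y
    unfolding openin_grp_top[OF G(1)] by (auto intro!: exI[of _ "{x}"])
  \<comment> \<open>Splitting by the intermediate point \<open>z = g x\<close> gives a union of open
    rectangles.\<close>
  have "{t \<in> topspace (prod_topology (grp_top G) (grp_top G)). (case t of (f, g) \<Rightarrow> f \<circ> g) x = y}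
      = (\<Union>z. {f \<in> G. f z = y} \<times> {g \<in> G. g x = z})"
    by (auto simp: topspace_grp_top[OF G(1)])
  also have "openin (prod_topology (grp_top G) (grp_top G)) \<dots>"
    by (intro openin_Union) (auto simp: openin_prod_Times_iff open1)
  finally show "openin (prod_topology (grp_top G) (grp_top G))
     {t \<in> topspace (prod_topology (grp_top G) (grp_top G)). (case t of (f, g) \<Rightarrow> f \<circ> g) x = y}" .
qed

lemma continuous_map_grp_top_inv:
  assumes "perm_group G"
  shows "continuous_map (grp_top G) (grp_top G) inv"
proof (rule continuous_map_grp_top)
  note G = perm_groupD[OF assms]
  show "G \<subseteq> Sym" by (fact G)
  show "inv f \<in> G" if "f \<in> topspace (grp_top G)" for f
    using that G(4) by (auto simp: topspace_grp_top[OF G(1)])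
  fix x y
  have "{f \<in> topspace (grp_top G). inv f x = y} = {f \<in> G. f y = x}"
    using G(5) by (auto simp: topspace_grp_top[OF G(1)] bij_is_inj bij_is_surj surj_f_inv_f)
  also have "openin (grp_top G) \<dots>"
    unfolding openin_grp_top[OF G(1)] by (auto intro!: exI[of _ "{y}"])
  finally show "openin (grp_top G) {f \<in> topspace (grp_top G). inv f x = y}" .
qed

section \<open>Polishness of closed permutation groups\<close>

text \<open>The space of all maps is a countable product of discrete spaces, hence completely
  metrizable. Injectivity is one open condition per pair and surjectivity one per point; as
  \<open>'x\<close> is countable, \<open>Sym\<close> is a G-delta.\<close>

lemma completely_metrizable_sym_top:
  "completely_metrizable_space (sym_top :: ('x::countable \<Rightarrow> 'x) topology)"
proof -
  let ?T = "pointwise_top :: ('x \<Rightarrow> 'x) topology"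
  have cm: "completely_metrizable_space ?T"
    unfolding pointwise_top_def
    by (auto simp: completely_metrizable_space_product_topology completely_metrizable_space_discrete_topology)
  have top: "topspace ?T = UNIV"
    by (simp add: pointwise_top_def)
  have inj: "gdelta_in ?T (\<Inter>p. {f. f (fst p) = f (snd p) \<longrightarrow> fst p = snd p})"
  proof (intro gdelta_in_Inter)
    show "gdelta_in ?T S" if "S \<in> range (\<lambda>p. {f. f (fst p) = f (snd p) \<longrightarrow> fst p = snd p})" for S
    proof -
      obtain x y where S: "S = {f. f x = f y \<longrightarrow> x = y}" using \<open>S \<in> _\<close> by auto
      have "openin ?T S"
        unfolding openin_pointwise_top S by (auto intro!: exI[of _ "{x, y}"])
      then show ?thesis by (rule open_imp_gdelta_in)
    qed
  qed auto
  have surj: "gdelta_in ?T (\<Inter>y. {f. \<exists>x. f x = y})"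
  proof (intro gdelta_in_Inter)
    show "gdelta_in ?T S" if "S \<in> range (\<lambda>y. {f. \<exists>x. f x = y})" for S
    proof -
      obtain y where S: "S = {f. \<exists>x. f x = y}" using \<open>S \<in> _\<close> by auto
      have "\<exists>F. finite F \<and> (\<forall>f'. (\<forall>z\<in>F. f' z = f z) \<longrightarrow> f' \<in> S)" if f: "f \<in> S" for f
      proof -
        obtain x where "f x = y" using f S by auto
        then show ?thesis by (intro exI[of _ "{x}"]) (auto simp: S)
      qed
      then have "openin ?T S"
        unfolding openin_pointwise_top by blast
      then show ?thesis by (rule open_imp_gdelta_in)
    qed
  qed auto
  have "Sym = (\<Inter>p. {f :: 'x \<Rightarrow> 'x. f (fst p) = f (snd p) \<longrightarrow> fst p = snd p}) \<inter> (\<Inter>y. {f. \<exists>x. f x = y})"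
    by (auto simp: Sym_def bij_def inj_def surj_def; metis)
  then have "gdelta_in ?T Sym"
    using gdelta_in_Int[OF inj surj] by simp
  then show ?thesis
    unfolding sym_top_def by (intro completely_metrizable_space_gdelta_in cm)
qed

lemma separable_grp_top:
  fixes G :: "('x::countable \<Rightarrow> 'x) set"
  assumes "G \<subseteq> Sym"
  shows "separable_space (grp_top G)"
proof -
  \<comment> \<open>\<open>pick\<close> selects an extension in G of each finite partial map, if
    there is one. Its range is countable because lists over \<open>'x\<close> are; intersecting with
    G discards the arbitrary values.\<close>
  define pick where "pick = (\<lambda>ps :: ('x \<times> 'x) list. SOME f. f \<in> G \<and> (\<forall>(x, y) \<in> set ps. f x = y))"
  let ?C = "range pick \<inter> G"
  have "f \<in> grp_top G closure_of ?C" if f: "f \<in> G" for f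
    unfolding in_closure_of
  proof (intro conjI allI impI)
    show "f \<in> topspace (grp_top G)" using f assms by (simp add: topspace_grp_top)
    fix U assume U: "f \<in> U \<and> openin (grp_top G) U"
    then obtain S where S: "finite S" "\<forall>f'\<in>G. (\<forall>x\<in>S. f' x = f x) \<longrightarrow> f' \<in> U"
      using openin_grp_top[OF assms] by metis
    obtain xs where xs: "set xs = S" using S(1) finite_list by blast
    let ?ps = "map (\<lambda>x. (x, f x)) xs"
    have "pick ?ps \<in> G \<and> (\<forall>(x, y) \<in> set ?ps. pick ?ps x = y)"
      unfolding pick_def by (rule someI[of _ f]) (use f in auto)
    then show "\<exists>y. y \<in> range pick \<inter> G \<and> y \<in> U"
      using S(2) xs by auto
  qed
  then have "grp_top G closure_of ?C = topspace (grp_top G)"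
    using closure_of_subset_topspace[of "grp_top G" ?C] by (auto simp: topspace_grp_top[OF assms])
  then show ?thesis
    unfolding separable_space_def
    by (intro exI[of _ ?C]) (auto simp: topspace_grp_top[OF assms])
qed

lemma Polish_closed_perm_group:
  fixes G :: "('x::countable \<Rightarrow> 'x) set"
  assumes "closed_perm_group G"
  shows "Polish_perm_group G"
proof -
  have G: "perm_group G" "closedin sym_top G"
    using assms by (auto simp: closed_perm_group_def)
  moreover have "completely_metrizable_space (grp_top G)"
    unfolding grp_top_def
    by (intro completely_metrizable_space_closedin completely_metrizable_sym_top G)
  ultimately show ?thesis
    by (simp add: Polish_perm_group_def Polish_space_def continuous_map_grp_top_comp
        continuous_map_grp_top_inv separable_grp_top perm_groupD)
qed

section \<open>Elements of the wreath product\<close>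

text \<open>For elements of the wreath product the target fibre does not depend on the point chosen
  in the source fibre, so \<open>undefined\<close> can serve as sample point.\<close>

definition base :: "('l \<times> 'w \<Rightarrow> 'l \<times> 'w) \<Rightarrow> 'w \<Rightarrow> 'w" where
  "base f w = snd (f (undefined, w))"

text \<open>Indexed by the source fibre, whereas \<open>wreath_action\<close> labels its maps by the
  target.\<close>

definition fibre :: "('l \<times> 'w \<Rightarrow> 'l \<times> 'w) \<Rightarrow> 'w \<Rightarrow> 'l \<Rightarrow> 'l" where
  "fibre f w l = fst (f (l, w))"

definition lift_perm :: "('w \<Rightarrow> 'w) \<Rightarrow> 'l \<times> 'w \<Rightarrow> 'l \<times> 'w" where
  "lift_perm \<pi> p = (fst p, \<pi> (snd p))"

definition at_fibre :: "'w \<Rightarrow> ('l \<Rightarrow> 'l) \<Rightarrow> 'l \<times> 'w \<Rightarrow> 'l \<times> 'w" where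
  "at_fibre w g p = (if snd p = w then (g (fst p), w) else p)"

text \<open>W(A) of the overview, a copy of the wreath product of G with Sym(A): it also contains
  the permutations of the index set that move only points of A.\<close>

definition wreath_on :: "('l \<Rightarrow> 'l) set \<Rightarrow> 'w set \<Rightarrow> ('l \<times> 'w \<Rightarrow> 'l \<times> 'w) set" where
  "wreath_on G A = {f \<in> wreath G. \<forall>l. \<forall>w. w \<notin> A \<longrightarrow> f (l, w) = (l, w)}"

lemma lift_perm_apply [simp]: "lift_perm \<pi> (l, w) = (l, \<pi> w)"
  by (simp add: lift_perm_def)

lemma lift_perm_comp: "lift_perm \<pi> \<circ> lift_perm \<rho> = lift_perm (\<pi> \<circ> \<rho>)"
  by (simp add: fun_eq_iff)

lemma wreathI:
  assumes "bij \<pi>" "\<And>w. gs w \<in> G"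
  shows "(\<lambda>(l, w). (gs w l, \<pi> w)) \<in> wreath G"
proof -
  have "(\<lambda>(l, w). (gs w l, \<pi> w)) = wreath_action (\<lambda>w. gs (inv \<pi> w)) \<pi>"
    using assms(1) by (auto simp: wreath_action_def fun_eq_iff bij_is_inj)
  then show ?thesis
    using assms unfolding wreath_def Sym_def by blast
qed

lemma wreath_decomp:
  assumes "f \<in> wreath G"
  shows "f (l, w) = (fibre f w l, base f w)" "fibre f w \<in> G" "bij (base f)"
proof -
  obtain gs s where f: "f = wreath_action gs s" "\<forall>w. gs w \<in> G" "bij s"
    using assms by (auto simp: wreath_def Sym_def)
  have "base f = s" and "fibre f w = gs (s w)"
    by (auto simp: f wreath_action_def base_def fibre_def fun_eq_iff)
  then show "f (l, w) = (fibre f w l, base f w)" "fibre f w \<in> G" "bij (base f)"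
    using f by (auto simp: wreath_action_def)
qed

lemma snd_wreath: "f \<in> wreath G \<Longrightarrow> snd (f p) = base f (snd p)"
  by (cases p) (simp add: wreath_decomp(1))

lemma bij_wreath:
  assumes "perm_group G" "f \<in> wreath G"
  shows "bij f"
proof (rule bijI)
  note f = wreath_decomp[OF assms(2)]
  have g: "bij (fibre f w)" for w
    using perm_groupD(5)[OF assms(1)] f(2) .
  show "inj f"
  proof (rule injI)
    fix p q assume eq: "f p = f q"
    obtain l w l' w' where p: "p = (l, w)" "q = (l', w')"
      by (cases p; cases q)
    have "base f w = base f w'" "fibre f w l = fibre f w' l'"
      using eq by (simp_all add: p f(1))
    moreover have "inj (base f)" "inj (fibre f w)"
      using f(3) g by (simp_all add: bij_is_inj)
    ultimately show "p = q"
      using p by (auto dest: injD)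
  qed
  show "surj f"
  proof (rule surjI)
    fix q
    show "f (inv (fibre f (inv (base f) (snd q))) (fst q), inv (base f) (snd q)) = q"
      using f(3) g by (simp add: f(1) bij_is_surj surj_f_inv_f)
  qed
qed

lemma perm_group_wreath:
  assumes "perm_group G"
  shows "perm_group (wreath G)"
  unfolding perm_group_def
proof (intro conjI ballI)
  note G = perm_groupD[OF assms]
  show "wreath G \<subseteq> Sym"
    using bij_wreath[OF assms] by (auto simp: Sym_def)
  have "id = (\<lambda>(l, w). (id l, id w))" by (simp add: fun_eq_iff)
  then show "id \<in> wreath G"
    using wreathI[of id "\<lambda>_. id" G] G(2) by simp
  fix f assume f: "f \<in> wreath G"
  note fd = wreath_decomp[OF f]
  show "f \<circ> h \<in> wreath G" if h: "h \<in> wreath G" for h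
  proof -
    note hd = wreath_decomp[OF h]
    have "f \<circ> h = (\<lambda>(l, w). ((fibre f (base h w) \<circ> fibre h w) l, (base f \<circ> base h) w))"
      by (simp add: fun_eq_iff hd(1) fd(1))
    also have "\<dots> \<in> wreath G"
      by (intro wreathI bij_comp hd fd G(3))
    finally show ?thesis .
  qed
  have "inv f p = (case p of (l, w) \<Rightarrow> (inv (fibre f (inv (base f) w)) l, inv (base f) w))" for p
  proof (rule inv_f_eq)
    show "inj f" using bij_wreath[OF assms f] by (rule bij_is_inj)
    show "f (case p of (l, w) \<Rightarrow> (inv (fibre f (inv (base f) w)) l, inv (base f) w)) = p"
      using fd(3) G(5)[OF fd(2)] by (cases p) (simp add: fd(1) bij_is_surj surj_f_inv_f)
  qed
  then have "inv f = (\<lambda>(l, w). (inv (fibre f (inv (base f) w)) l, inv (base f) w))"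
    by (simp add: fun_eq_iff)
  also have "\<dots> \<in> wreath G"
    by (intro wreathI bij_imp_bij_inv fd G(4))
  finally show "inv f \<in> wreath G" .
qed

lemma base_comp: "f \<in> wreath G \<Longrightarrow> base (f \<circ> h) w = base f (base h w)"
  by (simp add: base_def[of "f \<circ> h"] base_def[of h] snd_wreath)

lemma lift_perm_wreath:
  fixes G :: "('l \<Rightarrow> 'l) set"
  assumes "perm_group G" "bij \<pi>"
  shows "lift_perm \<pi> \<in> wreath G"
proof -
  have "lift_perm \<pi> = (\<lambda>(l :: 'l, w). (id l, \<pi> w))"
    by (simp add: fun_eq_iff)
  then show ?thesis
    using wreathI[OF assms(2), of "\<lambda>_. id" G] perm_groupD(2)[OF assms(1)] by simp
qed

lemma base_lift_perm [simp]: "base (lift_perm \<pi>) = \<pi>"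
  by (simp add: base_def fun_eq_iff)

lemma at_fibre_wreath:
  assumes "perm_group G" "g \<in> G"
  shows "at_fibre w g \<in> wreath G"
proof -
  have "at_fibre w g = (\<lambda>(l, w'). ((if w' = w then g else id) l, id w'))"
    by (auto simp: at_fibre_def fun_eq_iff)
  moreover have "(if w' = w then g else id) \<in> G" for w'
    using assms(2) perm_groupD(2)[OF assms(1)] by simp
  ultimately show ?thesis
    using wreathI[of id "\<lambda>w'. if w' = w then g else id" G] by simp
qed

lemma at_fibre_comp: "at_fibre w g \<circ> at_fibre w h = at_fibre w (g \<circ> h)"
  by (auto simp: at_fibre_def fun_eq_iff)

lemma at_fibre_id [simp]: "at_fibre w id = id"
  by (auto simp: at_fibre_def fun_eq_iff)

lemma inv_at_fibre: "bij g \<Longrightarrow> inv (at_fibre w g) = at_fibre w (inv g)"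
  by (rule inv_unique_comp) (simp_all add: at_fibre_comp bij_is_surj[THEN surj_iff[THEN iffD1]] bij_is_inj)

section \<open>Supports, conjugation and gluing\<close>

lemma wreath_onD:
  assumes "f \<in> wreath_on G A"
  shows "f \<in> wreath G" "w \<notin> A \<Longrightarrow> f (l, w) = (l, w)"
  using assms by (auto simp: wreath_on_def)

text \<open>\<open>base f\<close> fixes the complement of A pointwise, so injectivity keeps points
  of A inside A.\<close>

lemma wreath_on_base:
  assumes "f \<in> wreath_on G A"
  shows "base f w \<in> A \<longleftrightarrow> w \<in> A"
proof -
  have out: "base f v = v" if "v \<notin> A" for v
    using wreath_onD(2)[OF assms that] by (simp add: base_def)
  have "inj (base f)"
    using wreath_decomp(3)[OF wreath_onD(1)[OF assms]] by (rule bij_is_inj)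
  then show ?thesis using out by (metis injD)
qed

lemma wreath_on_conj:
  assumes G: "perm_group G" and f: "f \<in> wreath_on G A" and h: "h \<in> wreath G"
  shows "h \<circ> f \<circ> inv h \<in> wreath_on G (base h ` A)"
  unfolding wreath_on_def
proof (intro CollectI conjI allI impI)
  note W = perm_groupD[OF perm_group_wreath[OF G]]
  show "h \<circ> f \<circ> inv h \<in> wreath G"
    by (intro W h wreath_onD[OF f])
  fix l w assume w: "w \<notin> base h ` A"
  obtain q where q: "(l, w) = h q"
    using W(5)[OF h] by (metis bij_pointE)
  have "snd q \<notin> A"
    using w q snd_wreath[OF h, of q] by (metis imageI snd_conv)
  then have "f q = q"
    using wreath_onD(2)[OF f] by (metis prod.collapse)
  then show "(h \<circ> f \<circ> inv h) (l, w) = (l, w)"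
    using W(5)[OF h] by (simp add: q bij_is_inj)
qed

text \<open>The level sets of j are blocks, and \<open>u i\<close> preserves block i. Letting each
  \<open>u i\<close> act on its own block forms infinite products inside the wreath product.\<close>

lemma glue_wreath:
  assumes G: "perm_group G" and u: "\<And>i. u i \<in> wreath G"
    and j: "\<And>i w. j (base (u i) w) = i \<longleftrightarrow> j w = i"
  shows "(\<lambda>p. u (j (snd p)) p) \<in> wreath G"
proof -
  note d = wreath_decomp[OF u]
  have "bij (\<lambda>w. base (u (j w)) w)"
  proof (rule bijI)
    show "inj (\<lambda>w. base (u (j w)) w)"
    proof (rule injI)
      fix w v assume eq: "base (u (j w)) w = base (u (j v)) v"
      then have "j w = j v" using j by metis
      then show "w = v" using eq d(3) by (metis bij_is_inj injD)
    qed
    show "surj (\<lambda>w. base (u (j w)) w)"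
    proof (rule surjI)
      fix v
      let ?w = "inv (base (u (j v))) v"
      have w: "base (u (j v)) ?w = v" using d(3) by (simp add: bij_is_surj surj_f_inv_f)
      then have "j ?w = j v" using j by metis
      then show "base (u (j ?w)) ?w = v" using w by simp
    qed
  qed
  moreover have "(\<lambda>p. u (j (snd p)) p) = (\<lambda>(l, w). (fibre (u (j w)) w l, base (u (j w)) w))"
    by (simp add: fun_eq_iff d(1))
  ultimately show ?thesis
    using wreathI[of "\<lambda>w. base (u (j w)) w" "\<lambda>w. fibre (u (j w)) w" G] d(2) by simp
qed

section \<open>Closedness of the wreath product\<close>

text \<open>Membership is visible on finite sets: pairs of points show that a limit f permutes the
  fibres, and finite subsets of a single fibre put its fibre map into the closed group G.\<close>

lemma closed_perm_group_wreath:
  assumes "closed_perm_group (G :: ('l \<Rightarrow> 'l) set)"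
  shows "closed_perm_group (wreath G :: ('l \<times> 'w \<Rightarrow> 'l \<times> 'w) set)"
proof -
  have G: "perm_group G" and cl: "closedin sym_top G"
    using assms by (auto simp: closed_perm_group_def)
  note W = perm_group_wreath[OF G]
  have "f \<in> wreath G" if f: "f \<in> Sym"
    and approx: "\<And>S. finite S \<Longrightarrow> \<exists>f'\<in>wreath G. \<forall>x\<in>S. f' x = f x" for f :: "'l \<times> 'w \<Rightarrow> 'l \<times> 'w"
  proof -
    have bf: "bij f" using f by (simp add: Sym_def)
    have two: "snd (f p) = snd (f q) \<longleftrightarrow> snd p = snd q" for p q
    proof -
      obtain f' where f': "f' \<in> wreath G" "\<forall>x\<in>{p, q}. f' x = f x"
        using approx[of "{p, q}"] by auto
      have "bij (base f')" using wreath_decomp(3)[OF f'(1)] .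
      then have "base f' (snd p) = base f' (snd q) \<longleftrightarrow> snd p = snd q"
        by (metis bij_is_inj injD)
      moreover have "snd (f p) = base f' (snd p)" "snd (f q) = base f' (snd q)"
        using f'(2) snd_wreath[OF f'(1)] by (metis insertCI)+
      ultimately show ?thesis by simp
    qed
    have f_eq: "f (l, w) = (fibre f w l, base f w)" for l w
      using two[of "(l, w)" "(undefined, w)"] by (simp add: fibre_def base_def prod_eq_iff)
    have "bij (base f)"
    proof (rule bijI)
      show "inj (base f)"
        using two by (intro injI) (force simp: base_def)
      show "surj (base f)"
      proof (rule surjI)
        fix v
        show "base f (snd (inv f (undefined, v))) = v"
          using f_eq bf by (metis bij_is_surj snd_conv surj_f_inv_f prod.collapse)
      qed
    qed
    moreover have "fibre f w \<in> G" for w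
    proof (rule closedin_sym_topD[OF cl])
      have "bij (fibre f w)"
      proof (rule bijI)
        show "inj (fibre f w)"
          using bf f_eq by (intro injI) (metis bij_is_inj injD prod.inject)
        show "surj (fibre f w)"
        proof (rule surjI)
          fix l
          obtain l' w' where p: "f (l', w') = (l, base f w)"
            using bf by (metis bij_pointE prod.collapse)
          then have "w' = w" using two[of "(l', w')" "(undefined, w)"] by (simp add: base_def)
          then show "fibre f w (fst (inv f (l, base f w))) = l"
            using p bf by (metis bij_is_inj fibre_def fst_conv inv_f_f)
        qed
      qed
      then show "fibre f w \<in> Sym" by (simp add: Sym_def)
      fix S :: "'l set" assume "finite S"
      then obtain f' where f': "f' \<in> wreath G" "\<forall>x\<in>(\<lambda>l. (l, w)) ` S. f' x = f x"
        using approx[of "(\<lambda>l. (l, w)) ` S"] by auto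
      then show "\<exists>g\<in>G. \<forall>x\<in>S. g x = fibre f w x"
        by (intro bexI[of _ "fibre f' w"]) (use wreath_decomp(2)[OF f'(1)] f'(2) in \<open>simp_all add: fibre_def\<close>)
    qed
    ultimately have "(\<lambda>(l, w). (fibre f w l, base f w)) \<in> wreath G"
      by (rule wreathI)
    moreover have "f = (\<lambda>(l, w). (fibre f w l, base f w))"
      by (simp add: fun_eq_iff f_eq)
    ultimately show ?thesis by simp
  qed
  then show ?thesis
    unfolding closed_perm_group_def using W perm_groupD(1)[OF W] by (auto intro: closedin_sym_topI)
qed

section \<open>Subgroups generated by two supports\<close>

lemma infinite_split:
  assumes "infinite D"
  obtains D1 where "D1 \<subseteq> D" "infinite D1" "infinite (D - D1)"
proof -
  obtain f :: "nat \<Rightarrow> 'a" where f: "inj f" "range f \<subseteq> D"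
    using infinite_countable_subset[OF assms] by blast
  have inf: "infinite (range (\<lambda>n. f (2 * n)))" "infinite (range (\<lambda>n. f (2 * n + 1)))"
    by (intro range_inj_infinite injI; use injD[OF f(1)] in fastforce)+
  have "f (2 * m + 1) \<noteq> f (2 * n)" for m n
  proof
    assume "f (2 * m + 1) = f (2 * n)"
    then have "2 * m + 1 = 2 * n" using f(1) by (rule injD[rotated])
    then show False by presburger
  qed
  then have "range (\<lambda>n. f (2 * n + 1)) \<subseteq> D - range (\<lambda>n. f (2 * n))"
    using f(2) by auto
  then have "infinite (D - range (\<lambda>n. f (2 * n)))"
    using inf(2) infinite_super by blast
  then show ?thesis
    using that[of "range (\<lambda>n. f (2 * n))"] inf(1) f(2) by blast
qed

lemma ex_bij_betw_infinite:
  fixes A :: "'a::countable set" and B :: "'b::countable set"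
  assumes "infinite A" "infinite B"
  obtains \<phi> where "bij_betw \<phi> A B"
proof -
  have "bij_betw (to_nat_on A) A UNIV" "bij_betw (from_nat_into B) UNIV B"
    using assms by (auto intro: to_nat_on_infinite bij_betw_from_nat_into)
  then show ?thesis using that bij_betw_trans by blast
qed

text \<open>Countably infinite leftovers can always be matched by some bijection. This builds
  permutations with prescribed action on one set and controlled support.\<close>

lemma ex_perm_extending:
  fixes A1 A2 B1 B2 :: "'w::countable set"
  assumes \<phi>: "bij_betw \<phi> A1 B1" and inf: "infinite A2" "infinite B2"
    and disj: "A1 \<inter> A2 = {}" "B1 \<inter> B2 = {}" and un: "A1 \<union> A2 = B1 \<union> B2"
  obtains \<pi> where "bij \<pi>" "\<And>w. w \<in> A1 \<Longrightarrow> \<pi> w = \<phi> w" "\<pi> ` A2 = B2" "\<And>w. w \<notin> A1 \<union> A2 \<Longrightarrow> \<pi> w = w"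
proof -
  obtain \<psi> where \<psi>: "bij_betw \<psi> A2 B2"
    using ex_bij_betw_infinite[OF inf] .
  define \<pi> where "\<pi> w = (if w \<in> A1 then \<phi> w else if w \<in> A2 then \<psi> w else w)" for w
  have 1: "bij_betw \<pi> A1 B1"
    using \<phi> by (subst bij_betw_cong[of A1 \<pi> \<phi>]) (auto simp: \<pi>_def)
  have 2: "bij_betw \<pi> A2 B2"
    using \<psi> disj by (subst bij_betw_cong[of A2 \<pi> \<psi>]) (auto simp: \<pi>_def)
  have 3: "bij_betw \<pi> (- (A1 \<union> A2)) (- (A1 \<union> A2))"
    by (subst bij_betw_cong[of _ \<pi> id]) (auto simp: \<pi>_def)
  have "bij_betw \<pi> (A1 \<union> A2 \<union> - (A1 \<union> A2)) (B1 \<union> B2 \<union> - (A1 \<union> A2))"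
    using disj un by (intro bij_betw_combine 1 2 3) auto
  moreover have "B1 \<union> B2 \<union> - (A1 \<union> A2) = UNIV" "A1 \<union> A2 \<union> - (A1 \<union> A2) = UNIV"
    using un by blast+
  ultimately have "bij \<pi>" by simp
  moreover have "\<pi> ` A2 = B2" using 2 by (rule bij_betw_imp_surj_on)
  ultimately show ?thesis
    using that[of \<pi>] by (simp add: \<pi>_def)
qed

lemma wreath_on_mono: "A \<subseteq> B \<Longrightarrow> wreath_on G A \<subseteq> wreath_on G B"
  by (auto simp: wreath_on_def)

lemma lift_perm_wreath_on:
  assumes "perm_group G" "bij \<pi>" "\<And>w. w \<notin> A \<Longrightarrow> \<pi> w = w"
  shows "lift_perm \<pi> \<in> wreath_on G A"
  using assms by (simp add: wreath_on_def lift_perm_wreath)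

text \<open>Some a in W(A) agrees with g over D, because D and its image both leave infinitely much
  of A over. The quotient \<open>inv a \<circ> g\<close> fixes the fibres over D, and a conjugation
  by an element of W(A) moves its support into B.\<close>

lemma mem_wreath_on_Un_aux:
  fixes A B :: "'w::countable set"
  assumes G: "perm_group G" and H: "perm_group H"
    and AH: "wreath_on G A \<subseteq> H" and BH: "wreath_on G B \<subseteq> H"
    and inf: "infinite (A \<inter> B)" "infinite (A - B)"
    and g: "g \<in> wreath_on G (A \<union> B)"
    and D: "D \<subseteq> A" "infinite D" "infinite (A - D)" "base g ` D \<subseteq> A" "infinite (A - base g ` D)"
  shows "g \<in> H"
proof -
  note W = perm_groupD[OF perm_group_wreath[OF G]]
  note gW = wreath_onD(1)[OF g]
  note gd = wreath_decomp[OF gW]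
  have "bij_betw (base g) D (base g ` D)"
    using gd(3) by (meson bij_betw_subset subset_UNIV)
  then obtain \<pi> where \<pi>: "bij \<pi>" "\<And>w. w \<in> D \<Longrightarrow> \<pi> w = base g w"
      "\<And>w. w \<notin> D \<union> (A - D) \<Longrightarrow> \<pi> w = w"
    by (rule ex_perm_extending[OF _ D(3,5)]) (use D in auto)
  define a where "a = (\<lambda>(l, w). ((if w \<in> D then fibre g w else id) l, \<pi> w))"
  have "a \<in> wreath G"
    unfolding a_def using perm_groupD(2)[OF G] gd(2) \<pi>(1) by (intro wreathI) auto
  then have a: "a \<in> wreath_on G A"
    using \<pi>(3) D(1) by (auto simp: wreath_on_def a_def)
  have aW: "a \<in> wreath G" by fact
  define g' where "g' = inv a \<circ> g"
  have g': "g' \<in> wreath_on G (A \<union> B - D)"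
    unfolding wreath_on_def
  proof (intro CollectI conjI allI impI)
    show "g' \<in> wreath G" unfolding g'_def by (intro W aW gW)
    fix l w assume w: "w \<notin> A \<union> B - D"
    have "g (l, w) = a (l, w)"
    proof (cases "w \<in> D")
      case True
      then show ?thesis by (simp add: a_def gd(1) \<pi>(2))
    next
      case False
      then show ?thesis using w wreath_onD(2)[OF g] wreath_onD(2)[OF a] by simp
    qed
    then show "g' (l, w) = (l, w)"
      using W(5)[OF aW] by (simp add: g'_def bij_is_inj)
  qed
  obtain \<phi> where \<phi>: "bij_betw \<phi> D (A - B)"
    using ex_bij_betw_infinite[OF D(2) inf(2)] .
  obtain \<rho> where \<rho>: "bij \<rho>" "\<rho> ` (A - D) = A \<inter> B" "\<And>w. w \<notin> D \<union> (A - D) \<Longrightarrow> \<rho> w = w"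
    by (rule ex_perm_extending[OF \<phi> D(3) inf(1)]) (use D in auto)
  \<comment> \<open>Conjugation by b moves the fixed set D onto A - B, which pushes the support into B.\<close>
  define b where "b = (lift_perm \<rho> :: 'a \<times> 'w \<Rightarrow> 'a \<times> 'w)"
  have b: "b \<in> wreath_on G A"
    unfolding b_def using \<rho> D(1) by (intro lift_perm_wreath_on G) auto
  have "base b ` (A \<union> B - D) \<subseteq> B"
    using \<rho>(2,3) by (fastforce simp: b_def)
  then have "b \<circ> g' \<circ> inv b \<in> H"
    using wreath_on_conj[OF G g' wreath_onD(1)[OF b]] wreath_on_mono BH by blast
  then have "g' \<in> H"
    using a b AH perm_groupD(4)[OF H]
    by (simp add: perm_group_cancel[OF H] perm_group_cancel_right[OF H] subset_iff)
  then have "inv a \<circ> g \<in> H" by (simp add: g'_def)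
  then show "g \<in> H"
    using perm_group_cancel[OF H perm_groupD(4)[OF H]] a AH by blast
qed

text \<open>As \<open>base g\<close> preserves \<open>A \<union> B\<close>, it sends infinitely many
  points of A into A or infinitely many into B. The first case is the previous lemma; in the second,
  g is first multiplied by an element of W(B) that brings images into
  \<open>A \<inter> B\<close>.\<close>

lemma wreath_on_Un_subset:
  fixes A B :: "'w::countable set"
  assumes G: "perm_group G" and H: "perm_group H"
    and AH: "wreath_on G A \<subseteq> H" and BH: "wreath_on G B \<subseteq> H"
    and inf: "infinite (A \<inter> B)" "infinite (A - B)"
  shows "wreath_on G (A \<union> B) \<subseteq> H"
proof
  note W = perm_groupD[OF perm_group_wreath[OF G]]
  fix g assume g: "g \<in> wreath_on G (A \<union> B)"
  note gW = wreath_onD(1)[OF g]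
  have inj: "inj_on (base g) X" for X
    using wreath_decomp(3)[OF gW] by (meson bij_is_inj inj_on_subset subset_UNIV)
  have "A = {w \<in> A. base g w \<in> A} \<union> {w \<in> A. base g w \<in> B}"
    using wreath_on_base[OF g] by auto
  moreover have "infinite A"
    using inf(1) by auto
  ultimately consider "infinite {w \<in> A. base g w \<in> A}" | "infinite {w \<in> A. base g w \<in> B}"
    by (metis finite_UnI)
  then show "g \<in> H"
  proof cases
    case 1
    \<comment> \<open>Only part of the set is put into D; the infinite remainder makes D and its
      image co-infinite in A.\<close>
    then obtain D where D: "D \<subseteq> {w \<in> A. base g w \<in> A}" "infinite D"
        "infinite ({w \<in> A. base g w \<in> A} - D)"
      by (rule infinite_split)
    have "infinite (base g ` ({w \<in> A. base g w \<in> A} - D))"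
      using D(3) inj finite_image_iff by blast
    moreover have "base g ` ({w \<in> A. base g w \<in> A} - D) \<subseteq> A - base g ` D"
      using inj[of UNIV] by (auto dest: injD)
    ultimately have "infinite (A - base g ` D)"
      using infinite_super by blast
    moreover have "infinite (A - D)"
      using D(3) by (rule infinite_super[rotated]) auto
    ultimately show ?thesis
      using D by (intro mem_wreath_on_Un_aux[OF G H AH BH inf g, of D]) auto
  next
    case 2
    then obtain D where D: "D \<subseteq> {w \<in> A. base g w \<in> B}" "infinite D"
        "infinite ({w \<in> A. base g w \<in> B} - D)"
      by (rule infinite_split)
    \<comment> \<open>E is the new target for the image of D. Its infinite complement in
      \<open>A \<inter> B\<close> leaves room to extend within B and makes the new image co-infinite
      in A.\<close>
    obtain E where E: "E \<subseteq> A \<inter> B" "infinite E" "infinite (A \<inter> B - E)"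
      using inf(1) by (rule infinite_split)
    have "infinite (base g ` ({w \<in> A. base g w \<in> B} - D))"
      using D(3) inj finite_image_iff by blast
    moreover have "base g ` ({w \<in> A. base g w \<in> B} - D) \<subseteq> B - base g ` D"
      using inj[of UNIV] by (auto dest: injD)
    ultimately have inf1: "infinite (B - base g ` D)"
      using infinite_super by blast
    have inf2: "infinite (B - E)" "infinite (A - E)"
      using E(3) by (auto elim!: infinite_super[rotated])
    have "infinite (base g ` D)"
      using D(2) inj finite_image_iff by blast
    then obtain \<phi> where \<phi>: "bij_betw \<phi> (base g ` D) E"
      using ex_bij_betw_infinite E(2) by blast
    obtain \<rho> where \<rho>: "bij \<rho>" "\<And>w. w \<in> base g ` D \<Longrightarrow> \<rho> w = \<phi> w"
        "\<And>w. w \<notin> base g ` D \<union> (B - base g ` D) \<Longrightarrow> \<rho> w = w"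
      by (rule ex_perm_extending[OF \<phi> inf1 inf2(1)]) (use D E in auto)
    define b where "b = (lift_perm \<rho> :: 'a \<times> 'w \<Rightarrow> 'a \<times> 'w)"
    have b: "b \<in> wreath_on G B"
      unfolding b_def
    proof (intro lift_perm_wreath_on G \<rho>(1))
      show "\<rho> w = w" if "w \<notin> B" for w
        using that D(1) by (intro \<rho>(3)) auto
    qed
    have "base (b \<circ> g) w = \<rho> (base g w)" for w
      by (subst base_comp[OF wreath_onD(1)[OF b]]) (simp add: b_def)
    then have "base (b \<circ> g) ` D = \<phi> ` base g ` D"
      using \<rho>(2) by (simp add: image_image)
    then have im: "base (b \<circ> g) ` D = E"
      using \<phi> by (simp add: bij_betw_def)
    have "b \<circ> g \<in> wreath_on G (A \<union> B)"
      using W(3)[OF wreath_onD(1)[OF b] gW] wreath_onD(2)[OF b] wreath_onD(2)[OF g]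
      by (simp add: wreath_on_def)
    moreover have "infinite (A - D)"
      using D(3) by (rule infinite_super[rotated]) auto
    ultimately have "b \<circ> g \<in> H"
      using D(1,2) E(1) im inf2
      by (intro mem_wreath_on_Un_aux[OF G H AH BH inf, of _ D]) auto
    then show ?thesis
      using perm_group_cancel[OF H] b BH by blast
  qed
qed

section \<open>Almost disjoint families and the commutator swindle\<close>

text \<open>There are more sets of naturals than left cosets of H, so two of the \<open>t X\<close>
  share a coset. The pair can be ordered so that Y contains a number missing from X, which the later
  arguments exploit.\<close>

lemma small_index_pigeonhole:
  assumes G: "perm_group G" and H: "subgroup_of H G"
    and small: "ordLess2 (card_of (left_cosets G H)) (card_of (UNIV :: nat set set))"
    and t: "\<And>X :: nat set. t X \<in> G"
  obtains X Y where "\<not> Y \<subseteq> X" "inv (t X) \<circ> t Y \<in> H"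
proof -
  have Hg: "perm_group H" using H by (simp add: subgroup_of_def)
  define c where "c X = (\<lambda>h. t X \<circ> h) ` H" for X
  have "\<not> inj c"
  proof
    assume "inj c"
    moreover have "c X \<in> left_cosets G H" for X
      using t by (simp add: c_def left_cosets_def)
    ultimately have "ordLeq3 (card_of (UNIV :: nat set set)) (card_of (left_cosets G H))"
      by (intro card_of_ordLeqI[of c]) auto
    then show False using small not_ordLess_ordLeq by blast
  qed
  then obtain X Y where XY: "X \<noteq> Y" "c X = c Y" by (auto simp: inj_def)
  have same: "inv (t X) \<circ> t Y \<in> H" if "c X = c Y" for X Y
  proof -
    have "t Y \<circ> id \<in> c Y"
      unfolding c_def using perm_groupD(2)[OF Hg] by (rule imageI)
    then have "t Y \<in> c X"
      using that by simp
    then obtain h where h: "h \<in> H" "t Y = t X \<circ> h"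
      unfolding c_def by (elim imageE)
    have "inv (t X) \<circ> t Y = h"
      using perm_groupD(5)[OF G t[of X]] by (simp add: h(2) fun_eq_iff bij_is_inj)
    then show ?thesis using h(1) by simp
  qed
  show ?thesis
  proof (cases "Y \<subseteq> X")
    case True
    then show ?thesis using that[of X Y] XY same[of Y X] that[of Y X] by simp
  next
    case False
    then show ?thesis using that same XY(2) by blast
  qed
qed

text \<open>Distinct sets of naturals share only finitely many prefixes: the prefixes encode an almost
  disjoint family of the size of the continuum.\<close>

definition prefix :: "nat set \<Rightarrow> nat \<Rightarrow> bool list" where
  "prefix X n = map (\<lambda>i. i \<in> X) [0..<n]"

lemma length_prefix [simp]: "length (prefix X n) = n"
  by (simp add: prefix_def)

lemma prefix_eq_iff: "prefix X n = prefix Y m \<longleftrightarrow> n = m \<and> (\<forall>i<n. i \<in> X \<longleftrightarrow> i \<in> Y)"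
  unfolding prefix_def list_eq_iff_nth_eq by auto

lemma inj_prefix: "inj (prefix X)"
  by (rule injI) (simp add: prefix_eq_iff)

lemma prefix_separates:
  assumes "k \<in> Y" "k \<notin> X" "k < n"
  shows "prefix Y n \<notin> range (prefix X)"
  using assms by (auto simp: prefix_eq_iff)

text \<open>The element u acts on the i-th translate of B as the conjugate of g by the i-th power of the
  shift. Only the values of h on the fibres over A enter the conclusion, since both sides agree
  trivially elsewhere.\<close>

lemma swindle:
  fixes \<sigma> :: "'w \<Rightarrow> 'w" and g :: "'l \<times> 'w \<Rightarrow> 'l \<times> 'w"
  assumes G: "perm_group G" and \<sigma>: "bij \<sigma>"
    and inA: "\<And>w. w \<in> A \<Longrightarrow> \<sigma> w \<in> A" and outA: "\<And>w. w \<notin> A \<Longrightarrow> \<sigma> w = w"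
    and BA: "B \<subseteq> A" and wander: "\<And>i. i > 0 \<Longrightarrow> (\<sigma> ^^ i) ` B \<inter> B = {}"
    and g: "g \<in> wreath_on G B"
  obtains u where "u \<in> wreath_on G A"
    "\<And>h. h \<in> wreath G \<Longrightarrow> (\<And>w. base h w \<in> A \<longleftrightarrow> w \<in> A) \<Longrightarrow> (\<And>l w. w \<in> A \<Longrightarrow> h (l, w) = u (l, w)) \<Longrightarrow>
      h \<circ> lift_perm \<sigma> = g \<circ> lift_perm \<sigma> \<circ> h"
proof -
  note W = perm_groupD[OF perm_group_wreath[OF G]]
  define s where "s i = (lift_perm (\<sigma> ^^ i) :: 'l \<times> 'w \<Rightarrow> 'l \<times> 'w)" for i
  define D where "D i = (\<sigma> ^^ i) ` B" for i
  have bij: "bij (\<sigma> ^^ i)" for i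
    using \<sigma> by (rule bij_fn)
  have sW: "s i \<in> wreath G" for i
    unfolding s_def using G bij by (rule lift_perm_wreath)
  \<comment> \<open>Cancelling the smaller power of \<open>\<sigma>\<close> turns a common point of
    two translates into a return of B to itself, which \<open>wander\<close> excludes.\<close>
  have disj: "i = j" if "w \<in> D i" "w \<in> D j" for i j w
  proof -
    have "i \<ge> j" if ij: "w \<in> D i" "w \<in> D j" for i j
    proof (rule ccontr)
      assume "\<not> j \<le> i"
      then have j: "j = i + (j - i)" "j - i > 0" by simp_all
      obtain b c where bc: "b \<in> B" "w = (\<sigma> ^^ i) b" "c \<in> B" "w = (\<sigma> ^^ j) c"
        using ij by (auto simp: D_def)
      then have "(\<sigma> ^^ i) b = (\<sigma> ^^ i) ((\<sigma> ^^ (j - i)) c)"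
        using j(1) by (metis comp_apply funpow_add)
      then have "b = (\<sigma> ^^ (j - i)) c"
        using bij[of i] by (metis bij_is_inj injD)
      then show False using wander[OF j(2)] bc by blast
    qed
    then show ?thesis using that by (meson le_antisym)
  qed
  have D_Suc: "\<sigma> w \<in> D (Suc i) \<longleftrightarrow> w \<in> D i" for w i
  proof -
    have "D (Suc i) = \<sigma> ` D i"
      by (simp add: D_def image_comp)
    then show ?thesis
      using \<sigma> by (simp add: bij_is_inj inj_image_mem_iff)
  qed
  have D_0: "D 0 = B" by (simp add: D_def)
  have DA: "D i \<subseteq> A" for i
  proof (induction i)
    case (Suc i)
    then show ?case using inA by (auto simp: D_def)
  qed (simp add: D_0 BA)
  \<comment> \<open>Blocks for the gluing: \<open>Some i\<close> is the i-th translate of B and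
    \<open>None\<close> is everything else.\<close>
  define idx where "idx w = (if \<exists>i. w \<in> D i then Some (THE i. w \<in> D i) else None)" for w
  have idx: "idx w = Some i \<longleftrightarrow> w \<in> D i" for w i
    unfolding idx_def using disj by (auto intro: the_equality theI)
  define v where "v k = (case k of None \<Rightarrow> id | Some i \<Rightarrow> s i \<circ> g \<circ> inv (s i))" for k
  have v: "v (Some i) \<in> wreath_on G (D i)" for i
    using wreath_on_conj[OF G g sW[of i]] by (simp add: v_def D_def s_def)
  define u where "u p = v (idx (snd p)) p" for p
  have uD: "u (l, w) = v (Some i) (l, w)" if "w \<in> D i" for l w i
    using that idx[of w i] by (simp add: u_def)
  have uN: "u (l, w) = (l, w)" if "\<And>i. w \<notin> D i" for l w
    using that by (simp add: u_def idx_def v_def)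
  have "u \<in> wreath G"
    unfolding u_def
  proof (rule glue_wreath[OF G])
    show "v k \<in> wreath G" for k
      using wreath_onD(1)[OF v] W(2) by (cases k) (simp_all add: v_def)
    show "idx (base (v k) w) = k \<longleftrightarrow> idx w = k" for k w
    proof (cases k)
      case None
      then show ?thesis by (simp add: v_def base_def)
    next
      case (Some i)
      then show ?thesis by (simp add: idx wreath_on_base[OF v])
    qed
  qed
  then have u: "u \<in> wreath_on G A"
    using DA uN by (fastforce simp: wreath_on_def)
  have gout: "g p = p" if "snd p \<notin> B" for p
    using wreath_onD(2)[OF g that] by (metis prod.collapse)
  show ?thesis
  proof (rule that[OF u])
    fix h assume h: "h \<in> wreath G" "\<And>w. base h w \<in> A \<longleftrightarrow> w \<in> A" and hu: "\<And>l w. w \<in> A \<Longrightarrow> h (l, w) = u (l, w)"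
    \<comment> \<open>Outside A both \<open>\<sigma>\<close> and g are trivial. On the i-th
      translate, \<open>\<sigma>\<close> carries the action of h to that on the next translate,
      which misses B, so g does nothing there. On the rest of A, h is the identity.\<close>
    have "h (l, \<sigma> w) = g (lift_perm \<sigma> (h (l, w)))" for l w
    proof -
      consider "w \<notin> A" | i where "w \<in> D i" | "w \<in> A" "\<And>i. w \<notin> D i" by blast
      then show ?thesis
      proof cases
        case 1
        then have "snd (h (l, w)) \<notin> A"
          using h by (simp add: snd_wreath)
        moreover from this have "g (h (l, w)) = h (l, w)"
          using BA by (intro gout) blast
        ultimately have "lift_perm \<sigma> (h (l, w)) = h (l, w)" "g (h (l, w)) = h (l, w)"
          using outA by (simp_all add: lift_perm_def)
        then show ?thesis using 1 outA by simp
      next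
        case 2
        define q where "q = inv (s i) (l, w)"
        have sq: "s i q = (l, w)"
          using W(5)[OF sW] by (simp add: q_def bij_is_surj surj_f_inv_f)
        have "s (Suc i) q = lift_perm \<sigma> (s i q)"
          by (simp add: s_def lift_perm_def)
        then have "s (Suc i) q = (l, \<sigma> w)" by (simp add: sq)
        then have invs: "inv (s (Suc i)) (l, \<sigma> w) = q"
          using W(5)[OF sW] by (metis bij_is_inj inv_f_f)
        have w': "\<sigma> w \<in> D (Suc i)" using 2 by (simp add: D_Suc)
        have "h (l, \<sigma> w) = s (Suc i) (g q)"
          using hu w' DA invs by (simp add: uD[OF w'] v_def subset_iff)
        also have "\<dots> = lift_perm \<sigma> (s i (g q))"
          by (simp add: s_def lift_perm_def)
        also have "s i (g q) = h (l, w)"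
          using hu 2 DA by (simp add: uD[OF 2] v_def subset_iff q_def)
        finally have eq: "h (l, \<sigma> w) = lift_perm \<sigma> (h (l, w))" .
        have "snd (v (Some (Suc i)) (l, \<sigma> w)) \<in> D (Suc i)"
          using w' wreath_on_base[OF v] by (simp add: snd_wreath[OF wreath_onD(1)[OF v]])
        then have "snd (h (l, \<sigma> w)) \<in> D (Suc i)"
          using hu w' DA by (simp add: uD[OF w'] subset_iff)
        then have "snd (h (l, \<sigma> w)) \<notin> B"
          using disj[of _ 0 "Suc i"] by (auto simp: D_0)
        then show ?thesis using gout by (simp flip: eq)
      next
        case 3
        then have hw: "h (l, w) = (l, w)" using hu uN by simp
        have \<sigma>w: "\<sigma> w \<notin> D (Suc i)" for i using 3 by (simp add: D_Suc)
        show ?thesis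
        \<comment> \<open>B is the translate with index 0 and has no predecessor among the
          translates, so a point entering it from outside meets the uncancelled factor g.\<close>
        proof (cases "\<sigma> w \<in> B")
          case True
          have "s 0 = id" by (simp add: s_def fun_eq_iff)
          then have "v (Some 0) = g" by (simp add: v_def)
          then have "u (l, \<sigma> w) = g (l, \<sigma> w)"
            using uD[of "\<sigma> w" 0] True by (simp add: D_0)
          then have "h (l, \<sigma> w) = g (l, \<sigma> w)"
            using hu BA True by auto
          then show ?thesis by (simp add: hw)
        next
          case False
          then have "\<sigma> w \<notin> D i" for i
            using \<sigma>w by (cases i) (simp_all add: D_0)
          then have "h (l, \<sigma> w) = (l, \<sigma> w)" using hu uN inA 3(1) by simp
          then show ?thesis using gout False by (simp add: hw)
        qed
      qed
    qed
    then show "h \<circ> lift_perm \<sigma> = g \<circ> lift_perm \<sigma> \<circ> h"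
      by (simp add: fun_eq_iff)
  qed
qed

section \<open>Subgroups of small index\<close>

locale small_index_in_wreath =
  fixes G :: "('l \<Rightarrow> 'l) set" and H :: "('l \<times> 'w::countable \<Rightarrow> 'l \<times> 'w) set"
  assumes G: "perm_group G" and sub: "subgroup_of H (wreath G)"
    and small: "ordLess2 (card_of (left_cosets (wreath G) H)) (card_of (UNIV :: nat set set))"
begin

lemma perm_group_W: "perm_group (wreath G :: ('l \<times> 'w \<Rightarrow> 'l \<times> 'w) set)"
  using G by (rule perm_group_wreath)

lemmas W = perm_groupD[OF perm_group_W]

lemma H: "perm_group H" and HW: "H \<subseteq> wreath G"
  using sub by (simp_all add: subgroup_of_def)

section \<open>Supports A with W(A) inside H\<close>

text \<open>Diagonal argument: if every piece n had a counterexample \<open>u n\<close>, let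
  \<open>t X\<close> be the product of the \<open>u n\<close> with n in X. Two of these in one coset
  yield an element of H that agrees with \<open>u n\<close> on a piece n with n in Y but not in
  X.\<close>

lemma ex_full_piece:
  fixes j :: "'w \<Rightarrow> nat"
  obtains n where "\<And>u. u \<in> wreath_on G {w. j w = n} \<Longrightarrow>
    \<exists>h\<in>H. (\<forall>w. j (base h w) = j w) \<and> (\<forall>l w. j w = n \<longrightarrow> h (l, w) = u (l, w))"
proof (rule ccontr)
  assume "\<not> thesis"
  then have "\<forall>n. \<exists>u. u \<in> wreath_on G {w. j w = n} \<and>
      \<not> (\<exists>h\<in>H. (\<forall>w. j (base h w) = j w) \<and> (\<forall>l w. j w = n \<longrightarrow> h (l, w) = u (l, w)))"
    using that by meson
  then obtain u where u: "\<And>n. u n \<in> wreath_on G {w. j w = n}"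
    and no: "\<And>n h. h \<in> H \<Longrightarrow> (\<And>w. j (base h w) = j w) \<Longrightarrow>
      (\<And>l w. j w = n \<Longrightarrow> h (l, w) = u n (l, w)) \<Longrightarrow> False"
    by metis
  define t where "t X p = (if j (snd p) \<in> X then u (j (snd p)) p else p)" for X p
  have t: "t X \<in> wreath G" for X
  proof -
    have "(\<lambda>p. (\<lambda>n. if n \<in> X then u n else id) (j (snd p)) p) \<in> wreath G"
    proof (rule glue_wreath[OF G])
      show "(if n \<in> X then u n else id) \<in> wreath G" for n
        using wreath_onD(1)[OF u] W(2) by simp
      show "j (base (if n \<in> X then u n else id) w) = n \<longleftrightarrow> j w = n" for n w
        using wreath_on_base[OF u[of n], of w] by (simp add: base_def)
    qed
    also have "(\<lambda>p. (\<lambda>n. if n \<in> X then u n else id) (j (snd p)) p) = t X"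
      by (simp add: t_def fun_eq_iff)
    finally show ?thesis .
  qed
  have jt: "j (base (t X) w) = j w" for X w
    using wreath_on_base[OF u[of "j w"], of w] by (simp add: t_def base_def)
  obtain X Y where XY: "\<not> Y \<subseteq> X" "inv (t X) \<circ> t Y \<in> H"
    by (rule small_index_pigeonhole[OF perm_group_W sub small, of t, OF t])
  then obtain n where n: "n \<in> Y" "n \<notin> X" by blast
  define h where "h = inv (t X) \<circ> t Y"
  have th: "t X (h p) = t Y p" for p
    using W(5)[OF t[of X]] by (simp add: h_def bij_is_surj surj_f_inv_f)
  have hW: "h \<in> wreath G" unfolding h_def by (intro W t)
  show False
  proof (rule no[of h n])
    show "h \<in> H" using XY(2) by (simp add: h_def)
    show jh: "j (base h w) = j w" for w
    proof -
      have "j (base (t X \<circ> h) w) = j (base (t Y) w)" by (simp add: base_def th)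
      then show ?thesis by (simp add: base_comp[OF t] jt)
    qed
    fix l w assume "j w = n"
    then have "j (snd (h (l, w))) = n" using jh by (simp add: snd_wreath[OF hW])
    then have "t X (h (l, w)) = h (l, w)" using n(2) by (simp add: t_def)
    moreover have "t Y (l, w) = u n (l, w)" using n(1) \<open>j w = n\<close> by (simp add: t_def)
    ultimately show "h (l, w) = u n (l, w)" by (simp add: th)
  qed
qed

text \<open>The pigeonhole applied to shifts of a full piece puts into H the permutation
  \<open>\<sigma>\<close> needed for the swindle; fullness replaces the infinite product u by an
  element h of H.\<close>

lemma ex_moiety:
  assumes inf: "infinite (UNIV :: 'w set)"
  obtains B where "infinite B" "infinite (- B)" "wreath_on G B \<subseteq> H"
proof -
  \<comment> \<open>The coordinates are the piece, a binary string naming a column of that piece,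
    and an integer position in the column.\<close>
  have "infinite (UNIV :: (nat \<times> bool list \<times> int) set)"
    by (simp add: finite_prod)
  with inf obtain e :: "'w \<Rightarrow> nat \<times> bool list \<times> int" where e: "bij e"
    by (rule ex_bij_betw_infinite)
  define d where "d = inv e"
  have ed: "e (d x) = x" and de: "d (e w) = w" for x w
    using e by (simp_all add: d_def bij_is_inj bij_is_surj surj_f_inv_f)
  obtain n where n: "\<And>u. u \<in> wreath_on G {w. fst (e w) = n} \<Longrightarrow>
      \<exists>h\<in>H. (\<forall>w. fst (e (base h w)) = fst (e w)) \<and> (\<forall>l w. fst (e w) = n \<longrightarrow> h (l, w) = u (l, w))"
    using ex_full_piece[of "\<lambda>w. fst (e w)"] by blast
  \<comment> \<open>Only the columns of piece n named by prefixes of X move, by k positions.\<close>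
  define sh where "sh X k w = (case e w of (m, c, i) \<Rightarrow>
      if m = n \<and> c \<in> range (prefix X) then d (m, c, i + k) else w)" for X k w
  have sh_d: "sh X k (d (m, c, i)) = (if m = n \<and> c \<in> range (prefix X) then d (m, c, i + k) else d (m, c, i))"
    for X k m c i by (simp add: sh_def ed)
  have d_ind: "P w" if "\<And>m c i. P (d (m, c, i))" for P w
    using that de by (metis prod.collapse)
  have sh_neg: "sh X k \<circ> sh X (- k) = id" for X k
  proof
    show "(sh X k \<circ> sh X (- k)) w = id w" for w
      by (induction w rule: d_ind) (simp add: sh_d)
  qed
  have bij_sh: "bij (sh X k)" for X k
    using sh_neg[of X k] sh_neg[of X "- k"] by (intro o_bij) auto
  have inv_sh: "inv (lift_perm (sh X 1)) = lift_perm (sh X (- 1))" for X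
    using sh_neg[of X 1] sh_neg[of X "- 1"]
    by (intro inv_unique_comp) (simp_all add: lift_perm_comp, simp_all add: fun_eq_iff)
  obtain X Y where XY: "\<not> Y \<subseteq> X" and "inv (lift_perm (sh X 1)) \<circ> lift_perm (sh Y 1) \<in> H"
    by (rule small_index_pigeonhole[OF perm_group_W sub small, of "\<lambda>X. lift_perm (sh X 1)",
          OF lift_perm_wreath[OF G bij_sh]])
  \<comment> \<open>Columns named by prefixes of Y alone move up by one, those of X alone move down
    by one, and on common columns the two shifts cancel.\<close>
  define \<sigma> where "\<sigma> = sh X (- 1) \<circ> sh Y 1"
  have \<sigma>H: "lift_perm \<sigma> \<in> H"
    using \<open>_ \<in> H\<close> by (simp add: inv_sh lift_perm_comp \<sigma>_def)
  have "bij \<sigma>" unfolding \<sigma>_def by (intro bij_comp bij_sh)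
  obtain k where k: "k \<in> Y" "k \<notin> X" using XY by blast
  \<comment> \<open>The columns on which \<open>\<sigma>\<close> is a pure forward shift. There are
    infinitely many, since every prefix of Y longer than k records that k lies in Y.\<close>
  define Q where "Q = range (prefix Y) - range (prefix X)"
  define B where "B = (\<lambda>c. d (n, c, 0)) ` Q"
  have inj_d: "inj d" using e by (simp add: d_def bij_imp_bij_inv bij_is_inj)
  have "prefix Y ` {k<..} \<subseteq> Q"
    using prefix_separates[OF k] by (auto simp: Q_def)
  moreover have "infinite (prefix Y ` {k<..})"
    by (subst finite_image_iff) (use inj_prefix inj_on_subset infinite_Ioi in \<open>blast+\<close>)
  ultimately have "infinite Q" by (rule infinite_super)
  moreover have "inj_on (\<lambda>c. d (n, c, m)) Q" for m
    using inj_d by (auto intro!: inj_onI dest: injD)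
  ultimately have inf_Q: "infinite ((\<lambda>c. d (n, c, m)) ` Q)" for m
    using finite_image_iff by blast
  have "(\<lambda>c. d (n, c, 1)) ` Q \<subseteq> - B"
    using inj_d by (auto simp: B_def dest: injD)
  then have "infinite (- B)" using inf_Q infinite_super by blast
  moreover have "infinite B" using inf_Q by (simp add: B_def)
  moreover have "wreath_on G B \<subseteq> H"
  proof
    fix g assume g: "g \<in> wreath_on G B"
    have pow: "(\<sigma> ^^ i) (d (n, c, 0)) = d (n, c, int i)" if "c \<in> Q" for i c
      using that by (induction i) (auto simp: \<sigma>_def sh_d Q_def add.commute)
    have fst_\<sigma>: "fst (e (\<sigma> w)) = fst (e w)" for w
      by (induction w rule: d_ind) (simp add: \<sigma>_def sh_d ed)
    have out: "\<sigma> w = w" if "fst (e w) \<noteq> n" for w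
      using that by (induction w rule: d_ind) (simp add: \<sigma>_def sh_d ed)
    have wander: "(\<sigma> ^^ i) ` B \<inter> B = {}" if "i > 0" for i
      using that by (auto simp: B_def pow inj_eq[OF inj_d])
    obtain u where u: "u \<in> wreath_on G {w. fst (e w) = n}"
      and comm: "\<And>h. h \<in> wreath G \<Longrightarrow>
        (\<And>w. base h w \<in> {w. fst (e w) = n} \<longleftrightarrow> w \<in> {w. fst (e w) = n}) \<Longrightarrow>
        (\<And>l w. w \<in> {w. fst (e w) = n} \<Longrightarrow> h (l, w) = u (l, w)) \<Longrightarrow>
        h \<circ> lift_perm \<sigma> = g \<circ> lift_perm \<sigma> \<circ> h"
      by (rule swindle[OF G \<open>bij \<sigma>\<close>, of "{w. fst (e w) = n}" B g])
        (use fst_\<sigma> out wander g in \<open>auto simp: B_def ed\<close>)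
    obtain h where h: "h \<in> H" "\<forall>w. fst (e (base h w)) = fst (e w)"
        "\<forall>l w. fst (e w) = n \<longrightarrow> h (l, w) = u (l, w)"
      using n[OF u] by blast
    \<comment> \<open>The swindle applies to h because h agrees with u over piece n; the identity
      writes g as a quotient of elements of H.\<close>
    have "h \<circ> lift_perm \<sigma> = g \<circ> (lift_perm \<sigma> \<circ> h)"
      using comm[of h] h HW by (auto simp: comp_assoc)
    moreover have "h \<circ> lift_perm \<sigma> \<in> H" "lift_perm \<sigma> \<circ> h \<in> H"
      using h(1) \<sigma>H perm_groupD(3)[OF H] by blast+
    ultimately show "g \<in> H"
      using perm_group_cancel_right[OF H] by metis
  qed
  ultimately show ?thesis using that by blast
qed

text \<open>Involutions swap coded points of B with the complement of B. A product
  \<open>\<rho>\<close> of two of them lies in H, and the image of B under it covers almost all of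
  that complement; conjugation and \<open>wreath_on_Un_subset\<close> then join the two
  supports.\<close>

lemma ex_cofinite:
  assumes inf: "infinite (UNIV :: 'w set)"
  obtains F where "finite F" "wreath_on G (- F) \<subseteq> H"
proof -
  obtain B where B: "infinite B" "infinite (- B)" "wreath_on G B \<subseteq> H"
    using ex_moiety[OF inf] .
  \<comment> \<open>\<open>B'\<close> will hold the coded points, while \<open>B - B'\<close> stays
    fixed and keeps the overlap of B with its image infinite.\<close>
  obtain B' where B': "B' \<subseteq> B" "infinite B'" "infinite (B - B')"
    using infinite_split[OF B(1)] .
  obtain p :: "bool list \<Rightarrow> 'w" where p: "bij_betw p UNIV B'"
    using ex_bij_betw_infinite[OF infinite_UNIV_listI B'(2)] .
  obtain c :: "nat \<Rightarrow> 'w" where c: "bij_betw c UNIV (- B)"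
    using ex_bij_betw_infinite[OF infinite_UNIV_nat B(2)] .
  have inj_p: "p x = p y \<longleftrightarrow> x = y" for x y
    using p by (auto simp: bij_betw_def inj_eq)
  have inj_c: "c x = c y \<longleftrightarrow> x = y" for x y
    using c by (auto simp: bij_betw_def inj_eq)
  have pB: "p x \<in> B'" "p x \<in> B" for x
    using p B'(1) by (auto simp: bij_betw_def)
  have cB: "c x \<notin> B" for x
    using c by (auto simp: bij_betw_def)
  have pc: "p x \<noteq> c m" for x m
    using pB cB by metis
  \<comment> \<open>t X exchanges c n with the point of B coded by the n-th prefix of X, so that for large n
    the product of t X and t Y moves the point coded by the n-th prefix of X to c n.\<close>
  define t where "t X w = (if w \<in> range c then p (prefix X (inv c w))
      else if w \<in> range (p \<circ> prefix X) then c (length (inv p w)) else w)" for X w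
  have inv_c: "inv c (c m) = m" and inv_p: "inv p (p x) = x" for m x
    using p c by (simp_all add: bij_betw_def)
  have t_c: "t X (c m) = p (prefix X m)" for X m
    by (simp add: t_def inv_c)
  have t_p: "t X (p (prefix X m)) = c m" for X m
    using pc by (auto simp: t_def inv_p)
  have t_p': "t X (p x) = p x" if "x \<notin> range (prefix X)" for X x
    using that pc inj_p by (auto simp: t_def)
  have t_other: "t X w = w" if "w \<in> B - B'" for X w
    using that pB cB by (auto simp: t_def)
  have tt: "t X \<circ> t X = id" for X
  proof
    fix w
    consider m where "w = c m" | m where "w = p (prefix X m)"
      | "w \<notin> range c" "w \<notin> range (p \<circ> prefix X)" by auto
    then show "(t X \<circ> t X) w = id w"
      by cases (simp_all add: t_c t_p, simp add: t_def)
  qed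
  have bij_t: "bij (t X)" for X
    using tt by (intro o_bij)
  have inv_t: "inv (lift_perm (t X)) = lift_perm (t X)" for X
    by (intro inv_unique_comp) (simp_all add: lift_perm_comp tt, simp_all add: fun_eq_iff)
  obtain X Y where XY: "\<not> Y \<subseteq> X" and "inv (lift_perm (t X)) \<circ> lift_perm (t Y) \<in> H"
    by (rule small_index_pigeonhole[OF perm_group_W sub small, of "\<lambda>X. lift_perm (t X)",
          OF lift_perm_wreath[OF G bij_t]])
  define \<rho> where "\<rho> = t X \<circ> t Y"
  have \<rho>H: "lift_perm \<rho> \<in> H"
    using \<open>_ \<in> H\<close> by (simp add: inv_t lift_perm_comp \<rho>_def)
  have inj_\<rho>: "inj \<rho>"
    unfolding \<rho>_def by (intro bij_is_inj bij_comp bij_t)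
  obtain k where k: "k \<in> Y" "k \<notin> X" using XY by blast
  \<comment> \<open>From length k + 1 on, prefixes of X and Y disagree at position k.\<close>
  have sep: "prefix Y m \<notin> range (prefix X)" "prefix X m \<notin> range (prefix Y)" if "k < m" for m
    using prefix_separates[OF k that] that k by (auto simp: prefix_eq_iff)
  have \<rho>1: "\<rho> (p (prefix X m)) = c m" if "k < m" for m
    using sep[OF that] by (simp add: \<rho>_def t_p t_p')
  have \<rho>2: "\<rho> (c m) = p (prefix Y m)" if "k < m" for m
    using sep[OF that] by (simp add: \<rho>_def t_c t_p')
  have \<rho>3: "\<rho> w = w" if "w \<in> B - B'" for w
    using that by (simp add: \<rho>_def t_other)
  \<comment> \<open>Conjugation by the inverse of \<open>lift_perm \<rho>\<close> carries the
    support back to B.\<close>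
  have "wreath_on G (\<rho> ` B) \<subseteq> H"
  proof
    fix g assume g: "g \<in> wreath_on G (\<rho> ` B)"
    let ?r = "lift_perm \<rho> :: 'l \<times> 'w \<Rightarrow> 'l \<times> 'w"
    have r: "inv ?r \<in> H" "bij ?r"
      using \<rho>H perm_groupD[OF H] by auto
    have rr: "?r \<circ> inv ?r = id" "inv ?r \<circ> ?r = id"
      using r(2) by (simp_all add: bij_is_inj bij_is_surj surj_iff[symmetric])
    have "base (inv ?r) (\<rho> w) = w" for w
      using arg_cong[OF rr(2), of "\<lambda>f. base f w"] r(1) HW
      by (simp add: base_comp[of _ G] subset_iff base_def[of id])
    then have "base (inv ?r) ` \<rho> ` B = B"
      by (simp add: image_image)
    then have "inv ?r \<circ> g \<circ> inv (inv ?r) \<in> H"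
      using wreath_on_conj[OF G g subsetD[OF HW r(1)]] B(3) by (simp add: subset_iff)
    then show "g \<in> H"
      using r(1) perm_groupD(4)[OF H r(1)]
      by (simp add: perm_group_cancel[OF H] perm_group_cancel_right[OF H])
  qed
  moreover have "infinite (B \<inter> \<rho> ` B)"
  proof (rule infinite_super[OF _ B'(3)])
    show "B - B' \<subseteq> B \<inter> \<rho> ` B"
      using \<rho>3 by (metis (no_types, lifting) Diff_iff IntI image_eqI subsetI)
  qed
  moreover have "infinite (B - \<rho> ` B)"
  proof (rule infinite_super)
    \<comment> \<open>These points are images of points outside B, so injectivity of
      \<open>\<rho>\<close> keeps them out of the image of B.\<close>
    show "(\<lambda>m. p (prefix Y m)) ` {k<..} \<subseteq> B - \<rho> ` B"
    proof (intro image_subsetI DiffI pB)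
      fix m assume "m \<in> {k<..}"
      then have "\<rho> (c m) = p (prefix Y m)" by (simp add: \<rho>2)
      then show "p (prefix Y m) \<notin> \<rho> ` B"
        using cB inj_\<rho> by (metis imageE injD)
    qed
    have "inj (\<lambda>m. p (prefix Y m))"
      by (rule injI) (simp add: inj_p prefix_eq_iff)
    then show "infinite ((\<lambda>m. p (prefix Y m)) ` {k<..})"
      by (subst finite_image_iff) (use inj_on_subset infinite_Ioi in \<open>blast+\<close>)
  qed
  ultimately have "wreath_on G (B \<union> \<rho> ` B) \<subseteq> H"
    by (intro wreath_on_Un_subset[OF G H B(3)])
  \<comment> \<open>Prefixes of length at most k need not be separated, so \<open>c 0\<close> up to
    \<open>c k\<close> are left out.\<close>
  moreover have "- (c ` {..k}) \<subseteq> B \<union> \<rho> ` B"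
  proof
    fix w assume w: "w \<in> - (c ` {..k})"
    show "w \<in> B \<union> \<rho> ` B"
    proof (cases "w \<in> B")
      case False
      then obtain m where m: "w = c m" using c by (metis ComplI UNIV_I bij_betw_def imageE)
      then have "w = \<rho> (p (prefix X m))" using w \<rho>1[of m] by force
      then show ?thesis using pB by blast
    qed simp
  qed
  ultimately have "wreath_on G (- (c ` {..k})) \<subseteq> H"
    using wreath_on_mono by blast
  then show ?thesis by (rule that[rotated]) simp
qed

section \<open>The remaining fibres and openness of H\<close>

text \<open>The preimage of H under the embedding of G at coordinate w has index at most that of H,
  so the small index property of G applies.\<close>

lemma open_fibre_subgroup:
  assumes sip: "small_index_property G"
  shows "openin (grp_top G) {g \<in> G. at_fibre w g \<in> H}"
proof -
  note GD = perm_groupD[OF G]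
  define K where "K = {g \<in> G. at_fibre w g \<in> H}"
  have "perm_group K"
    unfolding perm_group_def
  proof (intro conjI ballI)
    show "K \<subseteq> Sym" "id \<in> K"
      using GD(1,2) perm_groupD(2)[OF H] by (auto simp: K_def)
    show "f \<circ> g \<in> K" if "f \<in> K" "g \<in> K" for f g
      using that GD(3) perm_groupD(3)[OF H] by (simp add: K_def flip: at_fibre_comp)
    show "inv f \<in> K" if "f \<in> K" for f
      using that GD(4,5) perm_groupD(4)[OF H] by (auto simp: K_def simp flip: inv_at_fibre)
  qed
  then have subK: "subgroup_of K G" by (auto simp: subgroup_of_def K_def)
  \<comment> \<open>Pulling back along the embedding of G as one fibre maps the cosets of H onto those of K.\<close>
  define pull where "pull D = {g \<in> G. at_fibre w g \<in> D}" for D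
  have "pull ((\<lambda>h. at_fibre w g \<circ> h) ` H) = (\<lambda>h. g \<circ> h) ` K" if g: "g \<in> G" for g
  proof (intro set_eqI iffI)
    fix f assume "f \<in> pull ((\<lambda>h. at_fibre w g \<circ> h) ` H)"
    then obtain h where f: "f \<in> G" "h \<in> H" "at_fibre w f = at_fibre w g \<circ> h"
      by (auto simp: pull_def)
    have g': "inv g \<circ> g = id" "g \<circ> inv g = id"
      using GD(5)[OF g] by (simp_all add: bij_is_inj bij_is_surj surj_iff[symmetric])
    have "at_fibre w (inv g \<circ> f) = (at_fibre w (inv g) \<circ> at_fibre w g) \<circ> h"
      by (simp add: comp_assoc f(3) flip: at_fibre_comp)
    then have "at_fibre w (inv g \<circ> f) = h"
      by (simp add: at_fibre_comp g')
    then have "inv g \<circ> f \<in> K"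
      using f g GD by (simp add: K_def)
    moreover have "f = g \<circ> (inv g \<circ> f)"
      by (simp add: g' flip: comp_assoc)
    ultimately show "f \<in> (\<lambda>h. g \<circ> h) ` K" by blast
  next
    fix f assume "f \<in> (\<lambda>h. g \<circ> h) ` K"
    then show "f \<in> pull ((\<lambda>h. at_fibre w g \<circ> h) ` H)"
      using g GD(3) by (auto simp: pull_def K_def simp flip: at_fibre_comp)
  qed
  then have "(\<lambda>h. g \<circ> h) ` K \<in> pull ` left_cosets (wreath G) H" if g: "g \<in> G" for g
    unfolding left_cosets_def using g at_fibre_wreath[OF G g, of w]
    by (intro image_eqI[of _ pull "(\<lambda>h. at_fibre w g \<circ> h) ` H"] imageI) simp_all
  then have "left_cosets G K \<subseteq> pull ` left_cosets (wreath G) H"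
    unfolding left_cosets_def[of G] by (rule image_subsetI)
  then have "ordLeq3 (card_of (left_cosets G K)) (card_of (left_cosets (wreath G) H))"
    by (rule ordLeq_transitive[OF card_of_mono1 card_of_image])
  then have "ordLess2 (card_of (left_cosets G K)) (card_of (UNIV :: nat set set))"
    using small by (rule ordLeq_ordLess_trans)
  then have "openin (grp_top G) K"
    using sip subK unfolding small_index_property_def by simp
  then show ?thesis by (simp add: K_def)
qed

text \<open>Induction on F: dividing by the part of f over one fibre makes the element trivial there
  and leaves it unchanged over the rest of F. Once F is exhausted it lies in W(A).\<close>

lemma mem_by_fibres:
  assumes "finite F" "wreath_on G A \<subseteq> H" "f \<in> wreath_on G (A \<union> F)"
    and "\<And>w. w \<in> F \<Longrightarrow> base f w = w" "\<And>w. w \<in> F \<Longrightarrow> at_fibre w (fibre f w) \<in> H"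
  shows "f \<in> H"
  using assms(1,3-)
proof (induction F arbitrary: f)
  case empty
  then show ?case using assms(2) by auto
next
  case (insert w F)
  let ?a = "at_fibre w (fibre f w)"
  have fW: "f \<in> wreath G" using insert.prems(1) by (rule wreath_onD)
  have a: "?a \<in> H" using insert.prems(3) by simp
  have bij: "bij ?a" using perm_groupD(5)[OF H a] .
  have aW: "?a \<in> wreath G" using a HW by blast
  have at_w: "?a (l, w) = f (l, w)" for l
    using insert.prems(2)[of w] by (simp add: at_fibre_def wreath_decomp(1)[OF fW])
  have inv_a: "inv ?a (l, v) = (l, v)" if "v \<noteq> w" for l v
    using bij that by (intro inv_f_eq) (simp_all add: bij_is_inj at_fibre_def)
  define f' where "f' = inv ?a \<circ> f"
  have f'_w: "f' (l, w) = (l, w)" for l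
    using bij at_w[of l] by (metis bij_is_inj comp_apply f'_def inv_f_f)
  have f'_F: "f' (l, v) = f (l, v)" if "v \<in> F" for l v
    using that insert.hyps(2) insert.prems(2)[of v] inv_a[of v]
    by (auto simp: f'_def wreath_decomp(1)[OF fW])
  have "f' \<in> H"
  proof (rule insert.IH)
    have "f' (l, v) = (l, v)" if "v \<notin> A \<union> F" for l v
    proof (cases "v = w")
      case False
      then show ?thesis
        using that wreath_onD(2)[OF insert.prems(1), of v] inv_a by (simp add: f'_def)
    qed (simp add: f'_w)
    moreover have "f' \<in> wreath G" unfolding f'_def by (intro W aW fW)
    ultimately show "f' \<in> wreath_on G (A \<union> F)" by (simp add: wreath_on_def)
    show "base f' v = v" if "v \<in> F" for v
      using that insert.prems(2)[of v] by (simp add: base_def f'_F)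
    show "at_fibre v (fibre f' v) \<in> H" if "v \<in> F" for v
    proof -
      have "fibre f' v = fibre f v" using that by (simp add: fibre_def fun_eq_iff f'_F)
      then show ?thesis using that insert.prems(3)[of v] by simp
    qed
  qed
  then show ?case
    using a by (simp add: f'_def perm_group_cancel[OF H] perm_groupD(4)[OF H])
qed

text \<open>A subgroup containing a basic neighbourhood of the identity is open. W(-F) takes care of
  all but finitely many fibres; over F, openness in G supplies finitely many points to fix.\<close>

lemma open_subgroup:
  assumes inf: "infinite (UNIV :: 'w set)" and sip: "small_index_property G"
  shows "openin (grp_top (wreath G)) H"
proof -
  obtain F where F: "finite F" "wreath_on G (- F) \<subseteq> H"
    using ex_cofinite[OF inf] .
  have "\<exists>L. finite L \<and> (\<forall>g\<in>G. (\<forall>l\<in>L. g l = l) \<longrightarrow> at_fibre w g \<in> H)" for w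
  proof -
    have "id \<in> {g \<in> G. at_fibre w g \<in> H}"
      using perm_groupD(2)[OF G] perm_groupD(2)[OF H] by simp
    then have "\<exists>L. finite L \<and> (\<forall>g\<in>G. (\<forall>l\<in>L. g l = id l) \<longrightarrow> g \<in> {g \<in> G. at_fibre w g \<in> H})"
      using open_fibre_subgroup[OF sip, of w] unfolding openin_grp_top[OF perm_groupD(1)[OF G]] by blast
    then show ?thesis by simp
  qed
  then have "\<exists>L. \<forall>w. finite (L w) \<and> (\<forall>g\<in>G. (\<forall>l\<in>L w. g l = l) \<longrightarrow> at_fibre w g \<in> H)"
    by (intro choice) simp
  then obtain L where L: "\<forall>w. finite (L w) \<and> (\<forall>g\<in>G. (\<forall>l\<in>L w. g l = l) \<longrightarrow> at_fibre w g \<in> H)" ..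
  \<comment> \<open>\<open>base\<close> is evaluated at \<open>undefined\<close>, so this point is
    added to make f fix the index w even when \<open>L w\<close> is empty.\<close>
  define S where "S = (\<Union>w\<in>F. insert undefined (L w) \<times> {w})"
  have "finite S" using F(1) L by (simp add: S_def)
  have near_id: "f \<in> H" if f: "f \<in> wreath G" "\<forall>p\<in>S. f p = p" for f
  proof (rule mem_by_fibres[OF F])
    show "f \<in> wreath_on G (- F \<union> F)" using f(1) by (simp add: wreath_on_def)
    fix w assume w: "w \<in> F"
    show "base f w = w" using w f(2) by (simp add: base_def S_def)
    have "fibre f w l = l" if "l \<in> L w" for l
      using that w f(2) by (simp add: fibre_def S_def)
    then show "at_fibre w (fibre f w) \<in> H"
      using L wreath_decomp(2)[OF f(1)] by simp
  qed
  show ?thesis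
    unfolding openin_grp_top[OF W(1)]
  proof (intro conjI ballI HW)
    fix f assume f: "f \<in> H"
    \<comment> \<open>The same S works at every f in H, because \<open>inv f \<circ> f'\<close>
      fixes the points where f and \<open>f'\<close> agree.\<close>
    have "f' \<in> H" if f': "f' \<in> wreath G" "\<forall>p\<in>S. f' p = f p" for f'
    proof -
      have "inv f \<circ> f' \<in> H"
      proof (rule near_id)
        show "inv f \<circ> f' \<in> wreath G" using f f' HW W by blast
        show "\<forall>p\<in>S. (inv f \<circ> f') p = p"
          using f'(2) perm_groupD(5)[OF H f] by (simp add: bij_is_inj)
      qed
      then show ?thesis using f by (simp add: perm_group_cancel[OF H] perm_groupD(4)[OF H])
    qed
    then show "\<exists>S. finite S \<and> (\<forall>f'\<in>wreath G. (\<forall>x\<in>S. f' x = f x) \<longrightarrow> f' \<in> H)"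
      using \<open>finite S\<close> by (intro exI[of _ S]) simp
  qed
qed

end

theorem theorem6p2:
  fixes G :: "('l::countable \<Rightarrow> 'l) set"
  assumes "infinite (UNIV :: 'l set)"
    and "infinite (UNIV :: 'w::countable set)"
    and "closed_perm_group G"
    and "has_comeager_conj_class G"
    and "small_index_property G"
  shows "Polish_perm_group (wreath G :: ('l \<times> 'w \<Rightarrow> 'l \<times> 'w) set)
    \<and> small_index_property (wreath G :: ('l \<times> 'w \<Rightarrow> 'l \<times> 'w) set)"
proof
  show "Polish_perm_group (wreath G :: ('l \<times> 'w \<Rightarrow> 'l \<times> 'w) set)"
    by (intro Polish_closed_perm_group closed_perm_group_wreath assms)
  have "small_index_in_wreath G H" if "subgroup_of H (wreath G :: ('l \<times> 'w \<Rightarrow> 'l \<times> 'w) set)"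
    "ordLess2 (card_of (left_cosets (wreath G) H)) (card_of (UNIV :: nat set set))" for H
    using that assms(3) by unfold_locales (simp_all add: closed_perm_group_def)
  then show "small_index_property (wreath G :: ('l \<times> 'w \<Rightarrow> 'l \<times> 'w) set)"
    unfolding small_index_property_def
    using small_index_in_wreath.open_subgroup assms(2,5) by blast
qed

end
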